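(* Let $k,n>1$ be integers and suppose $n<k$ and $k\equiv1\pmod n$. Then the lattices $G_1,G_4<\operatorname{Aut}(X_{k,kn})$ described in the context are not abstractly commensurable.
   Context: Labeled graphs. A labeled graph is a connected graph in which each edge carries a non-zero integer at each of its two ends. It defines a graph of groups with all vertex and edge groups $\mathbb{Z}$, where the inclusion of an edge group into the vertex group at one of its ends is multiplication by the label at that end. The group defined by a labeled graph is the fundamental group of this graph of groups. The groups. Each is defined by a labeled graph with exactly two vertices $v$ and $u$, all edges joining $v$ to $u$; an edge with labels $(x,y)$ has label $x$ at $v$ and $y$ at $u$. - $G_1$: two edges, with labels $(k,kn)$ and $(kn,k)$. (It is the index-2 subgroup $\langle a,tat^{-1},t^2\rangle$ of $BS(k,kn)=\langle a,t\mid ta^kt^{-1}=a^{kn}\rangle$.) - $G_4$: $k$ edges with labels $(n,1)$, one edge with labels $(1,n)$, and $(k-1)/n$ edges with labels $(n,n^2)$. Both groups act freely and cocompactly on the 2-complex $X_{k,kn}$ and are thereby uniform lattices in the locally compact group $\operatorname{Aut}(X_{k,kn})$. Here $X_{k,kn}$ is the universal cover, with induced cell structure, of the 2-complex with one vertex, 1-cells $a,t_0,\dots,t_{k-1}$ and $k$ 2-cells attached along $t_iat_{i+1}^{-1}a^{-n}$ (indices modulo $k$), and $\operatorname{Aut}$ denotes the group of cell-structure-preserving homeomorphisms modulo those inducing the identity on the set of cells, topologized by the subbasis $\{f\mid f(\sigma)=\tau\}$, $\sigma,\tau$ cells. Two groups are abstractly commensurable if they have isomorphic finite-index subgroups. 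*)

theory Defs
  imports
    "HOL-Algebra.Coset"
    "HOL-Number_Theory.Cong"
    "Graph_Theory.Digraph_Component"
begin

section \<open>Groups given by generators and relators\<close>

text \<open>A letter \<open>(g, True)\<close> stands for the generator \<open>g\<close> and \<open>(g, False)\<close> for its inverse.\<close>

type_synonym 'g word = "('g \<times> bool) list"

definition words :: "'g set \<Rightarrow> 'g word set" where
  "words S = lists (S \<times> UNIV)"

definition gen_pow :: "'g \<Rightarrow> int \<Rightarrow> 'g word" where
  "gen_pow g i = replicate (nat \<bar>i\<bar>) (g, i \<ge> 0)"

inductive_set word_cong :: "'g set \<Rightarrow> 'g word set \<Rightarrow> ('g word \<times> 'g word) set"
  for S :: "'g set" and R :: "'g word set" where
  refl: "x \<in> words S \<Longrightarrow> (x, x) \<in> word_cong S R"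
| sym: "(x, y) \<in> word_cong S R \<Longrightarrow> (y, x) \<in> word_cong S R"
| trans: "(x, y) \<in> word_cong S R \<Longrightarrow> (y, z) \<in> word_cong S R \<Longrightarrow> (x, z) \<in> word_cong S R"
| append: "(x, x') \<in> word_cong S R \<Longrightarrow> (y, y') \<in> word_cong S R
    \<Longrightarrow> (x @ y, x' @ y') \<in> word_cong S R"
| cancel: "g \<in> S \<Longrightarrow> ([(g, b), (g, \<not> b)], []) \<in> word_cong S R"
| relator: "r \<in> R \<Longrightarrow> r \<in> words S \<Longrightarrow> (r, []) \<in> word_cong S R"

definition presented_group :: "'g set \<Rightarrow> 'g word set \<Rightarrow> 'g word set monoid" where
  "presented_group S R =
    \<lparr> carrier = words S // word_cong S R,
      monoid.mult = (\<lambda>A B. \<Union>x\<in>A. \<Union>y\<in>B. word_cong S R `` {x @ y}),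
      monoid.one = word_cong S R `` {[]} \<rparr>"

lemma words_append: "x @ y \<in> words S \<longleftrightarrow> x \<in> words S \<and> y \<in> words S"
  by (auto simp: words_def)

lemma word_cong_words: "(x, y) \<in> word_cong S R \<Longrightarrow> x \<in> words S \<and> y \<in> words S"
  by (induction rule: word_cong.induct) (auto simp: words_def)

lemma equiv_word_cong: "equiv (words S) (word_cong S R)"
  by (intro equivI refl_onI symI transI)
     (auto dest: word_cong_words intro: word_cong.intros)

lemma presented_group_mult:
  assumes "x \<in> words S" "y \<in> words S"
  shows "(word_cong S R `` {x}) \<otimes>\<^bsub>presented_group S R\<^esub> (word_cong S R `` {y})
    = word_cong S R `` {x @ y}"
proof -
  have "congruent2 (word_cong S R) (word_cong S R) (\<lambda>x y. word_cong S R `` {x @ y})"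
    by (auto simp: congruent2_def intro!: equiv_class_eq[OF equiv_word_cong] word_cong.append)
  then show ?thesis
    using UN_equiv_class2[OF equiv_word_cong equiv_word_cong _ assms]
    by (simp add: presented_group_def)
qed

lemma word_cong_inverse:
  "x \<in> words S \<Longrightarrow> (rev (map (map_prod id Not) x) @ x, []) \<in> word_cong S R"
proof (induction x)
  case Nil
  then show ?case by (auto intro: word_cong.refl)
next
  case (Cons l x)
  obtain g b where l: "l = (g, b)" by (cases l)
  have g: "g \<in> S" and x: "x \<in> words S" using Cons.prems l by (auto simp: words_def)
  let ?i = "rev (map (map_prod id Not) x)"
  have i: "?i \<in> words S" using word_cong_words[OF Cons.IH[OF x]] unfolding words_append by blast
  have "([(g, \<not> b), (g, b)] @ x, [] @ x) \<in> word_cong S R"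
    using word_cong.cancel[OF g, of "\<not> b"] x by (intro word_cong.append word_cong.refl) auto
  then have "(?i @ ([(g, \<not> b), (g, b)] @ x), ?i @ ([] @ x)) \<in> word_cong S R"
    by (rule word_cong.append[OF word_cong.refl[OF i]])
  then have "(rev (map (map_prod id Not) (l # x)) @ l # x, ?i @ x) \<in> word_cong S R"
    by (simp add: l)
  then show ?case using Cons.IH[OF x] word_cong.trans by blast
qed

lemma group_presented_group: "group (presented_group S R)"
proof (rule groupI)
  let ?G = "presented_group S R" and ?c = "\<lambda>x. word_cong S R `` {x}"
  have car: "carrier ?G = words S // word_cong S R" and one: "\<one>\<^bsub>?G\<^esub> = ?c []"
    by (simp_all add: presented_group_def)
  have nil: "[] \<in> words S" by (simp add: words_def)
  show "\<one>\<^bsub>?G\<^esub> \<in> carrier ?G" using nil by (auto simp: car one quotient_def)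
  show "A \<otimes>\<^bsub>?G\<^esub> B \<in> carrier ?G" if "A \<in> carrier ?G" "B \<in> carrier ?G" for A B
    using that by (auto simp: car elim!: quotientE simp: presented_group_mult words_append
        intro!: quotientI)
  show "A \<otimes>\<^bsub>?G\<^esub> B \<otimes>\<^bsub>?G\<^esub> C = A \<otimes>\<^bsub>?G\<^esub> (B \<otimes>\<^bsub>?G\<^esub> C)"
    if "A \<in> carrier ?G" "B \<in> carrier ?G" "C \<in> carrier ?G" for A B C
    using that by (auto simp: car elim!: quotientE simp: presented_group_mult words_append)
  show "\<one>\<^bsub>?G\<^esub> \<otimes>\<^bsub>?G\<^esub> A = A" if "A \<in> carrier ?G" for A
    using that nil by (auto simp: car one elim!: quotientE simp: presented_group_mult)
  show "\<exists>B\<in>carrier ?G. B \<otimes>\<^bsub>?G\<^esub> A = \<one>\<^bsub>?G\<^esub>" if A: "A \<in> carrier ?G" for A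
  proof -
    obtain x where x: "x \<in> words S" "A = ?c x" using A unfolding car by (blast elim: quotientE)
    let ?i = "rev (map (map_prod id Not) x)"
    have i: "(?i @ x, []) \<in> word_cong S R" using x by (simp add: word_cong_inverse)
    then have iw: "?i \<in> words S" using word_cong_words words_append by blast
    have "?c ?i \<otimes>\<^bsub>?G\<^esub> A = \<one>\<^bsub>?G\<^esub>"
      using presented_group_mult[OF iw x(1)] equiv_class_eq[OF equiv_word_cong i]
      by (simp add: x(2) one)
    moreover have "?c ?i \<in> carrier ?G" using iw by (simp add: car quotientI)
    ultimately show ?thesis by blast
  qed
qed


section \<open>Labeled graphs and their groups\<close>

text \<open>Each geometric edge is represented by one arc; its orientation is an arbitrary choice.
  The two labels sit at the tail and at the head of the arc.\<close>

record ('v, 'e) labeled_graph = "('v, 'e) pre_digraph" +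
  tail_label :: "'e \<Rightarrow> int"
  head_label :: "'e \<Rightarrow> int"

definition is_labeled_graph :: "('v, 'e) labeled_graph \<Rightarrow> bool" where
  "is_labeled_graph \<Gamma> \<longleftrightarrow>
    wf_digraph (pre_digraph.truncate \<Gamma>) \<and>
    Digraph_Component.connected (pre_digraph.truncate \<Gamma>) \<and>
    (\<forall>e\<in>arcs \<Gamma>. tail_label \<Gamma> e \<noteq> 0 \<and> head_label \<Gamma> e \<noteq> 0)"

text \<open>A set of edges whose union with the vertex set is a spanning tree: connected, and every edge
  is a bridge, i.e. lies on no circuit. The constant \<^const>\<open>Digraph_Component.spanning_tree\<close> is
  not suitable, because it excludes only directed cycles.\<close>

definition is_spanning_tree :: "('v, 'e) labeled_graph \<Rightarrow> 'e set \<Rightarrow> bool" where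
  "is_spanning_tree \<Gamma> T \<longleftrightarrow> T \<subseteq> arcs \<Gamma> \<and>
    Digraph_Component.connected ((pre_digraph.truncate \<Gamma>)\<lparr>arcs := T\<rparr>) \<and>
    (\<forall>e\<in>T. \<not> Digraph_Component.connected ((pre_digraph.truncate \<Gamma>)\<lparr>arcs := T - {e}\<rparr>))"

datatype ('v, 'e) generator = Vertex_Gen 'v | Edge_Gen 'e

text \<open>For an arc \<open>e\<close> from \<open>v\<close> to \<open>u\<close> with labels \<open>x\<close> at \<open>v\<close> and \<open>y\<close> at \<open>u\<close>, the generator of the edge
  group is sent to the \<open>x\<close>-th power of the generator \<open>a\<^sub>v\<close> and to the \<open>y\<close>-th power of \<open>a\<^sub>u\<close>; the
  stable letter \<open>t\<^sub>e\<close> conjugates the second image to the first.\<close>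

definition edge_relator :: "('v, 'e) labeled_graph \<Rightarrow> 'e \<Rightarrow> ('v, 'e) generator word" where
  "edge_relator \<Gamma> e =
    gen_pow (Edge_Gen e) 1 @ gen_pow (Vertex_Gen (head \<Gamma> e)) (head_label \<Gamma> e) @
    gen_pow (Edge_Gen e) (-1) @ gen_pow (Vertex_Gen (tail \<Gamma> e)) (- tail_label \<Gamma> e)"

text \<open>The fundamental group of the graph of groups defined by \<open>\<Gamma>\<close>, relative to a spanning tree \<open>T\<close>
  (Serre's presentation). Up to isomorphism it does not depend on \<open>T\<close>.\<close>

definition fundamental_group ::
  "('v, 'e) labeled_graph \<Rightarrow> 'e set \<Rightarrow> ('v, 'e) generator word set monoid" where
  "fundamental_group \<Gamma> T =
    presented_group (Vertex_Gen ` verts \<Gamma> \<union> Edge_Gen ` arcs \<Gamma>)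
      (edge_relator \<Gamma> ` arcs \<Gamma> \<union> (\<lambda>e. gen_pow (Edge_Gen e) 1) ` T)"


section \<open>The groups \<open>G\<^sub>1\<close> and \<open>G\<^sub>4\<close>\<close>

datatype vertex = V | U

text \<open>The labeled graph with vertices \<^term>\<open>V\<close>, \<^term>\<open>U\<close> and one edge from \<^term>\<open>V\<close> to \<^term>\<open>U\<close>
  for each entry \<open>(x, y)\<close> of the list.\<close>

definition two_vertex_graph :: "(int \<times> int) list \<Rightarrow> (vertex, nat) labeled_graph" where
  "two_vertex_graph ls =
    \<lparr> verts = {V, U}, arcs = {..<length ls}, tail = (\<lambda>_. V), head = (\<lambda>_. U),
      tail_label = (\<lambda>i. fst (ls ! i)), head_label = (\<lambda>i. snd (ls ! i)) \<rparr>"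

definition graph1 :: "nat \<Rightarrow> nat \<Rightarrow> (vertex, nat) labeled_graph" where
  "graph1 k n = two_vertex_graph [(int k, int k * int n), (int k * int n, int k)]"

definition graph4 :: "nat \<Rightarrow> nat \<Rightarrow> (vertex, nat) labeled_graph" where
  "graph4 k n = two_vertex_graph
    (replicate k (int n, 1) @ [(1, int n)] @ replicate ((k - 1) div n) (int n, (int n)\<^sup>2))"

lemma two_vertex_graph_connected_iff:
  "Digraph_Component.connected ((pre_digraph.truncate (two_vertex_graph ls))\<lparr>arcs := T\<rparr>)
    \<longleftrightarrow> T \<noteq> {}"
  (is "Digraph_Component.connected ?H \<longleftrightarrow> _")
proof -
  let ?P = "with_proj (mk_symmetric ?H)"
  have P: "verts ?P = {V, U}" "arcs_ends ?P = (if T = {} then {} else {(V, U), (U, V)})"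
    by (auto simp: mk_symmetric_def pre_digraph.truncate_def two_vertex_graph_def arcs_ends_def
        arc_to_ends_def)
  show ?thesis
  proof (cases "T = {}")
    case True
    have "\<not> V \<rightarrow>\<^sup>*\<^bsub>?P\<^esub> U"
      using True P by (auto simp: reachable_def elim: rtrancl_on.cases)
    then show ?thesis using True P
      by (auto simp: Digraph_Component.connected_def strongly_connected_def)
  next
    case False
    have "a \<rightarrow>\<^sup>*\<^bsub>?P\<^esub> b" if "a \<in> {V, U}" "b \<in> {V, U}" for a b
    proof (cases "a = b")
      case True
      then show ?thesis using that P by (auto simp: reachable_def)
    next
      case neq: False
      have "(a, a) \<in> rtrancl_on (verts ?P) (arcs_ends ?P)" using that P by auto
      moreover have "(a, b) \<in> arcs_ends ?P" using neq that P False by auto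
      ultimately show ?thesis using that P
        unfolding reachable_def by (metis rtrancl_on_into_rtrancl_on)
    qed
    then show ?thesis using False P
      by (auto simp: Digraph_Component.connected_def strongly_connected_def)
  qed
qed

lemma is_spanning_tree_two_vertex_graph:
  "is_spanning_tree (two_vertex_graph ls) T \<longleftrightarrow> (\<exists>i<length ls. T = {i})"
proof -
  have "T \<noteq> {} \<and> (\<forall>e\<in>T. T - {e} = {}) \<longleftrightarrow> (\<exists>i. T = {i})" by blast
  then show ?thesis
    unfolding is_spanning_tree_def two_vertex_graph_connected_iff
    by (auto simp: two_vertex_graph_def)
qed

lemma is_labeled_graph_two_vertex_graph:
  assumes "ls \<noteq> []" "\<forall>(x, y)\<in>set ls. x \<noteq> 0 \<and> y \<noteq> 0"
  shows "is_labeled_graph (two_vertex_graph ls)"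
proof -
  let ?H = "pre_digraph.truncate (two_vertex_graph ls)"
  have "?H\<lparr>arcs := arcs ?H\<rparr> = ?H" by simp
  moreover have "arcs ?H \<noteq> {}"
    using assms(1) by (auto simp: pre_digraph.truncate_def two_vertex_graph_def)
  ultimately have "Digraph_Component.connected ?H"
    using two_vertex_graph_connected_iff[where ls = ls and T = "arcs ?H"] by simp
  moreover have "wf_digraph ?H"
    by unfold_locales (auto simp: pre_digraph.truncate_def two_vertex_graph_def)
  moreover have "fst (ls ! i) \<noteq> 0 \<and> snd (ls ! i) \<noteq> 0" if "i < length ls" for i
    using assms(2) nth_mem[OF that] by (auto simp: case_prod_beta)
  ultimately show ?thesis
    by (auto simp: is_labeled_graph_def two_vertex_graph_def)
qed

lemma graph1_wf:
  assumes "k > 1" "n > 1"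
  shows "is_labeled_graph (graph1 k n)" "is_spanning_tree (graph1 k n) {0}"
  using assms unfolding graph1_def
  by (auto simp: is_spanning_tree_two_vertex_graph intro!: is_labeled_graph_two_vertex_graph)

lemma graph4_wf:
  assumes "k > 1" "n > 1"
  shows "is_labeled_graph (graph4 k n)" "is_spanning_tree (graph4 k n) {0}"
  using assms unfolding graph4_def
  by (auto simp: is_spanning_tree_two_vertex_graph intro!: is_labeled_graph_two_vertex_graph)

definition G1 :: "nat \<Rightarrow> nat \<Rightarrow> (vertex, nat) generator word set monoid" where
  "G1 k n = fundamental_group (graph1 k n) {0}"

definition G4 :: "nat \<Rightarrow> nat \<Rightarrow> (vertex, nat) generator word set monoid" where
  "G4 k n = fundamental_group (graph4 k n) {0}"


section \<open>Abstract commensurability\<close>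

definition finite_index_subgroup :: "'a set \<Rightarrow> ('a, 'c) monoid_scheme \<Rightarrow> bool" where
  "finite_index_subgroup H G \<longleftrightarrow> subgroup H G \<and> finite (rcosets\<^bsub>G\<^esub> H)"

definition abstractly_commensurable ::
  "('a, 'c) monoid_scheme \<Rightarrow> ('b, 'd) monoid_scheme \<Rightarrow> bool" where
  "abstractly_commensurable G H \<longleftrightarrow>
    (\<exists>A B. finite_index_subgroup A G \<and> finite_index_subgroup B H \<and>
      G\<lparr>carrier := A\<rparr> \<cong> H\<lparr>carrier := B\<rparr>)"

end

theory Submission
  imports Defs "HOL-Algebra.Bij"
begin

text \<open>An element is elliptic if it fixes a vertex of the Bass--Serre tree. A finite-index subgroup of
  \<open>G\<^sub>4\<close> contains an elliptic \<open>b \<noteq> 1\<close> such that everything commuting with \<open>b ^ (k n)\<close> commutes with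
  \<open>b ^ k\<close>: let \<open>b\<close> be a power of the generator at \<open>U\<close> with exponent not divisible by \<open>n\<close>. The subtree
  fixed by \<open>b ^ (k n)\<close> then arises from that fixed by \<open>b ^ k\<close> by attaching leaves over \<open>V\<close> along the
  edges with label \<open>1\<close> at \<open>V\<close>, and leaves do not enlarge the centralizer. In \<open>G\<^sub>1\<close>, which has
  index two in \<open>BS(k, k n)\<close>, no such \<open>b\<close> exists: the subtree fixed by \<open>b ^ (k n)\<close> has
  additional branches, through which the axis of a hyperbolic element commuting with \<open>b ^ (k n)\<close> passes.
  That \<open>b\<close> is elliptic is expressed algebraically by \<open>s b ^ N = b s\<close> with \<open>N > 1\<close>: this
  provides roots of \<open>b\<close> of arbitrarily large order, whereas the translation length of a hyperbolic element
  bounds the order of its roots.\<close>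

section \<open>Groups\<close>

text \<open>The exponents \<open>k\<close> and \<open>k n\<close>, rather than \<open>1\<close> and
  \<open>n\<close>, are dictated by \<open>G\<^sub>1\<close>. In \<open>BS(k, k n)\<close> a power
  of \<open>a\<close> crosses the stable letter only if \<open>k\<close> divides its exponent, so it
  is the \<open>k\<close>-th power of an elliptic element whose exponent can be freed from all
  factors \<open>n\<close> by conjugation. What remains is \<open>a ^ (k y)\<close> with
  \<open>n\<close> not dividing \<open>y\<close>; the edge with label \<open>k n\<close> lets its
  \<open>n\<close>-th power pass but not the element itself. In \<open>G\<^sub>4\<close> the extra
  factor is harmless, because \<open>[k = 1] (mod n)\<close> makes it prime to \<open>n\<close>.
  Both groups are mapped injectively into HNN extensions of the integers, where centralizers can be
  read off from normal forms: an exponent is pushed along a word, and each label must divide what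
  reaches it. For \<open>G\<^sub>4\<close> the labels are powers of \<open>n\<close>, and the two
  labels of an edge differ by an even power. The invariant has to survive in subgroups of finite
  index. In \<open>G\<^sub>4\<close> this calls for a power of \<open>v\<close> in the subgroup with
  exponent not divisible by \<open>n\<close>; in \<open>G\<^sub>1\<close> for a hyperbolic element
  all of whose positive powers fail to commute with \<open>a ^ (k y)\<close>.\<close>

context group
begin

lemma conj_mult:
  assumes "h \<in> carrier G" "x \<in> carrier G" "y \<in> carrier G"
  shows "(h \<otimes> x \<otimes> inv h) \<otimes> (h \<otimes> y \<otimes> inv h) = h \<otimes> (x \<otimes> y) \<otimes> inv h"
proof -
  have "inv h \<otimes> (h \<otimes> (y \<otimes> inv h)) = y \<otimes> inv h"
    using assms by (simp flip: m_assoc)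
  then show ?thesis using assms by (simp add: m_assoc)
qed

lemma conj_int_pow:
  assumes "h \<in> carrier G" "x \<in> carrier G"
  shows "(h \<otimes> x \<otimes> inv h) [^] (z :: int) = h \<otimes> x [^] z \<otimes> inv h"
proof -
  have "(\<lambda>x. h \<otimes> x \<otimes> inv h) \<in> hom G G"
    using assms(1) by (intro homI) (auto simp: conj_mult)
  from hom_int_pow[OF this assms(2) is_group is_group] show ?thesis by simp
qed

lemma conj_nat_pow:
  assumes "h \<in> carrier G" "x \<in> carrier G"
  shows "(h \<otimes> x \<otimes> inv h) [^] (j :: nat) = h \<otimes> x [^] j \<otimes> inv h"
  using conj_int_pow[OF assms, of "int j"] by (simp add: int_pow_int)

lemma conj_commute_iff:
  assumes "h \<in> carrier G" "x \<in> carrier G" "y \<in> carrier G"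
  shows "(h \<otimes> x \<otimes> inv h) \<otimes> (h \<otimes> y \<otimes> inv h) = (h \<otimes> y \<otimes> inv h) \<otimes> (h \<otimes> x \<otimes> inv h)
    \<longleftrightarrow> x \<otimes> y = y \<otimes> x"
  using assms by (simp add: conj_mult)

lemma intertwine_int_pow:
  assumes "h \<in> carrier G" "x \<in> carrier G" "y \<in> carrier G" "h \<otimes> x = y \<otimes> h"
  shows "h \<otimes> x [^] (z :: int) = y [^] z \<otimes> h"
proof -
  have "h \<otimes> x \<otimes> inv h = y" using assms(1-3) by (simp add: assms(4)) (simp add: m_assoc)
  then have "y [^] z = h \<otimes> x [^] z \<otimes> inv h" using conj_int_pow[OF assms(1,2)] by simp
  then show ?thesis using assms(1-3) by (simp add: m_assoc)
qed

lemma intertwine_inv: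
  assumes "h \<in> carrier G" "x \<in> carrier G" "y \<in> carrier G" "h \<otimes> x = y \<otimes> h"
  shows "inv h \<otimes> y = x \<otimes> inv h"
proof -
  have "inv h \<otimes> y = inv h \<otimes> (y \<otimes> h) \<otimes> inv h" using assms(1-3) by (simp add: m_assoc)
  also have "\<dots> = x \<otimes> inv h" using assms(1-3) by (simp flip: assms(4) m_assoc)
  finally show ?thesis .
qed

lemma int_pow_of_additive:
  assumes h: "\<And>z. h z \<in> carrier G" "\<And>y z :: int. h (y + z) = h y \<otimes> h z"
  shows "h 1 [^] z = h z"
proof -
  have "h 0 \<otimes> h 0 = h 0" using h(2)[of 0 0] by simp
  then have 0: "h 0 = \<one>" using h(1)[of 0] by (metis l_cancel_one')
  have nat: "h 1 [^] j = h (int j)" for j :: nat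
    by (induction j) (use h 0 in \<open>auto simp: add.commute simp flip: h(2)\<close>)
  show ?thesis
  proof (cases "z \<ge> 0")
    case True
    then show ?thesis using nat[of "nat z"] int_pow_int[of G "h 1" "nat z"] by simp
  next
    case False
    then have "h z = inv (h (- z))" using h(1) h(2)[of z "- z"] 0 by (metis inv_equality add.right_inverse)
    then show ?thesis
      using False nat[of "nat (- z)"] int_pow_neg_int[of "h 1" "nat (- z)"] h(1) by simp
  qed
qed

lemma subgroup_nat_pow_closed:
  assumes "subgroup H G" "x \<in> H"
  shows "x [^] (j :: nat) \<in> H"
  by (induction j) (use assms in \<open>auto intro: subgroup.m_closed subgroup.one_closed\<close>)

text \<open>For a subgroup that is not normal, the index may fail as exponent. Two of the cosets of
  \<open>g ^ 0, ..., g ^ c\<close>, with \<open>c\<close> the index, coincide, which puts a power of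
  \<open>g\<close> with exponent between \<open>1\<close> and \<open>c\<close> into
  \<open>H\<close>; the factorial of \<open>c\<close> is a multiple of each such exponent and serves
  all \<open>g\<close> at once.\<close>

lemma pow_in_finite_index_subgroup:
  assumes "finite_index_subgroup H G"
  obtains D :: nat where "D > 0" "\<forall>g\<in>carrier G. g [^] D \<in> H"
proof -
  have H: "subgroup H G" and fin: "finite (rcosets H)"
    using assms by (auto simp: finite_index_subgroup_def)
  let ?c = "card (rcosets H)"
  have "g [^] (fact ?c :: nat) \<in> H" if g: "g \<in> carrier G" for g
  proof -
    let ?f = "\<lambda>i::nat. H #> g [^] i"
    have "?f ` {0..?c} \<subseteq> rcosets H"
      using g subgroup.subset[OF H] by (auto intro: rcosetsI)
    then have "card (?f ` {0..?c}) \<le> ?c" using fin by (rule card_mono[rotated])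
    then have "\<not> inj_on ?f {0..?c}" by (intro pigeonhole) simp
    then obtain i j where ij: "i < j" "j \<le> ?c" "?f i = ?f j"
      unfolding inj_on_def by (metis atLeastAtMost_iff linorder_neqE_nat)
    have "g [^] j = g [^] (j - i) \<otimes> g [^] i" using g ij(1) by (simp add: nat_pow_mult)
    moreover have "g [^] j \<in> H #> g [^] i"
      using ij(3) rcos_self[OF _ H, of "g [^] j"] g by simp
    ultimately have "g [^] (j - i) \<in> H"
      using g subgroup.subset[OF H] by (auto simp: r_coset_def)
    moreover have "j - i dvd fact ?c" using ij by (intro dvd_fact) auto
    then obtain q where "fact ?c = (j - i) * q" by blast
    ultimately show ?thesis
      using g subgroup.subset[OF H] subgroup_nat_pow_closed[OF H, of "g [^] (j - i)" q]
      by (simp flip: nat_pow_pow)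
  qed
  then show thesis using that[of "fact ?c"] by simp
qed

text \<open>The relation says that \<open>c\<close> is the \<open>N\<close>-th power of its own
  conjugate by \<open>s\<close>. Conjugating an \<open>N ^ i\<close>-th root of \<open>c\<close> by
  \<open>s\<close> therefore yields an \<open>N ^ (i + 1)\<close>-th root.\<close>

lemma ex_unbounded_roots:
  assumes "c \<in> carrier G" "s \<in> carrier G" "(N :: nat) \<ge> 2" "s \<otimes> c [^] N = c \<otimes> s"
  shows "\<exists>r\<in>carrier G. \<exists>j>L. c = r [^] (j :: nat)"
proof -
  have c: "c = s \<otimes> c [^] N \<otimes> inv s" using assms by (simp add: m_assoc)
  have "\<exists>r\<in>carrier G. c = r [^] (N ^ i)" for i :: nat
  proof (induction i)
    case 0
    then show ?case using assms(1) by (intro bexI[of _ c]) simp_all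
  next
    case (Suc i)
    then obtain r where r: "r \<in> carrier G" "c = r [^] (N ^ i)" by blast
    have "c = (s \<otimes> r \<otimes> inv s) [^] (N ^ Suc i)"
      using r assms(2) c by (simp add: conj_nat_pow nat_pow_pow mult.commute)
    then show ?case using r(1) assms(2) by (intro bexI[of _ "s \<otimes> r \<otimes> inv s"]) simp_all
  qed
  moreover have "L < N ^ L"
    by (rule order.strict_trans2[OF less_exp power_mono]) (use assms(3) in auto)
  ultimately show ?thesis by blast
qed

end

lemma BijGroup_apply:
  assumes "f \<in> Bij S" "g \<in> Bij S" "x \<in> S"
  shows "(f \<otimes>\<^bsub>BijGroup S\<^esub> g) x = f (g x)"
  using assms by (simp add: BijGroup_def compose_def)

lemma int_power_decompose:
  assumes "(z :: int) \<noteq> 0" "n > (1 :: nat)"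
  obtains i y where "z = y * int n ^ i" "\<not> int n dvd y"
proof -
  have "\<not> is_unit (int n)" using assms(2) by (simp add: zdvd1_eq)
  then show thesis
    using assms(1) that multiplicity_decompose'[of z "int n"] by (metis mult.commute)
qed

section \<open>Presented groups\<close>

definition word_eval :: "('a, 'c) monoid_scheme \<Rightarrow> ('g \<Rightarrow> 'a) \<Rightarrow> 'g word \<Rightarrow> 'a" where
  "word_eval H f w = foldr (\<lambda>(g, b) z. (if b then f g else inv\<^bsub>H\<^esub> f g) \<otimes>\<^bsub>H\<^esub> z) w \<one>\<^bsub>H\<^esub>"

lemma word_eval_Nil [simp]: "word_eval H f [] = \<one>\<^bsub>H\<^esub>"
  by (simp add: word_eval_def)

lemma word_eval_Cons [simp]:
  "word_eval H f ((g, b) # w) = (if b then f g else inv\<^bsub>H\<^esub> f g) \<otimes>\<^bsub>H\<^esub> word_eval H f w"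
  by (simp add: word_eval_def)

lemma words_Nil [simp]: "[] \<in> words S"
  and words_Cons [simp]: "(g, b) # w \<in> words S \<longleftrightarrow> g \<in> S \<and> w \<in> words S"
  by (auto simp: words_def)

lemma gen_pow_words [simp]: "gen_pow g i \<in> words S \<longleftrightarrow> i = 0 \<or> g \<in> S"
  by (auto simp: words_def gen_pow_def in_lists_conv_set)

context group
begin

lemma word_eval_closed [simp]:
  assumes "f ` S \<subseteq> carrier G" "w \<in> words S"
  shows "word_eval G f w \<in> carrier G"
  using assms(2) by (induction w) (use assms(1) in \<open>auto simp: image_subset_iff\<close>)

lemma word_eval_append:
  assumes "f ` S \<subseteq> carrier G" "w \<in> words S" "w' \<in> words S"
  shows "word_eval G f (w @ w') = word_eval G f w \<otimes> word_eval G f w'"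
  using assms(2)
proof (induction w)
  case Nil
  show ?case using word_eval_closed[OF assms(1,3)] by simp
next
  case (Cons l w)
  obtain g b where l: "l = (g, b)" by (cases l)
  have "f g \<in> carrier G" "w \<in> words S" using Cons.prems assms(1) l by auto
  then show ?case
    using Cons.IH word_eval_closed[OF assms(1)] assms(3) l by (simp add: m_assoc)
qed

lemma word_eval_gen_pow:
  assumes "f g \<in> carrier G"
  shows "word_eval G f (gen_pow g i) = f g [^] i"
proof -
  have "word_eval G f (replicate j (g, b)) = (if b then f g else inv f g) [^] j" for j b
  proof (induction j)
    case (Suc j)
    have "(if b then f g else inv f g) \<in> carrier G" using assms by simp
    from nat_pow_Suc2[OF this, of j] show ?case using Suc by simp
  qed simp
  note pow = this
  show ?thesis
  proof (cases "i \<ge> 0")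
    case True
    then show ?thesis using int_pow_int[of G "f g" "nat i"] by (simp add: gen_pow_def pow)
  next
    case False
    then show ?thesis
      using assms int_pow_neg_int[of "f g" "nat (- i)"] by (simp add: gen_pow_def pow int_pow_inv)
  qed
qed

lemma word_eval_cong:
  assumes "f ` S \<subseteq> carrier G" "\<And>r. r \<in> R \<Longrightarrow> r \<in> words S \<Longrightarrow> word_eval G f r = \<one>"
    and "(w, w') \<in> word_cong S R"
  shows "word_eval G f w = word_eval G f w'"
  using assms(3)
proof (induction rule: word_cong.induct)
  case (append x x' y y')
  then show ?case
    using word_cong_words[OF append.hyps(1)] word_cong_words[OF append.hyps(2)]
    by (simp add: word_eval_append[OF assms(1)])
next
  case (cancel g b)
  then have "f g \<in> carrier G" using assms(1) by auto
  then show ?case by simp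
qed (use assms(2) in auto)

text \<open>The word pattern covers both \<open>edge_relator\<close> and the HNN relators below, so
  both kinds of presentation are handled through the equation on the right.\<close>

lemma word_eval_edge_relator:
  assumes f: "f ` S \<subseteq> carrier G" and S: "s \<in> S" "a \<in> S" "b \<in> S"
  shows "word_eval G f (gen_pow s 1 @ gen_pow a y @ gen_pow s (-1) @ gen_pow b (- x)) = \<one>
    \<longleftrightarrow> f s \<otimes> f a [^] y = f b [^] x \<otimes> f s"
proof -
  have c: "f s \<in> carrier G" "f a \<in> carrier G" "f b \<in> carrier G" using f S by auto
  let ?u = "f s \<otimes> f a [^] y"
  have "word_eval G f (gen_pow s 1 @ gen_pow a y @ gen_pow s (-1) @ gen_pow b (- x))
      = ?u \<otimes> inv (f b [^] x \<otimes> f s)"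
    using S c by (simp add: word_eval_append[OF f] words_append word_eval_gen_pow m_assoc
        inv_mult_group int_pow_neg)
  also have "\<dots> = \<one> \<longleftrightarrow> ?u = f b [^] x \<otimes> f s"
    using c inv_solve_right[of \<one> ?u "f b [^] x \<otimes> f s"] by auto
  finally show ?thesis .
qed

end

definition gen_class :: "'g set \<Rightarrow> 'g word set \<Rightarrow> 'g \<Rightarrow> 'g word set" where
  "gen_class S R g = word_cong S R `` {[(g, True)]}"

lemma class_carrier: "w \<in> words S \<Longrightarrow> word_cong S R `` {w} \<in> carrier (presented_group S R)"
  by (auto simp: presented_group_def quotient_def)

lemma gen_class_carrier [simp]: "g \<in> S \<Longrightarrow> gen_class S R g \<in> carrier (presented_group S R)"
  unfolding gen_class_def by (rule class_carrier) simp

lemma one_presented_group: "\<one>\<^bsub>presented_group S R\<^esub> = word_cong S R `` {[]}"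
  by (simp add: presented_group_def)

lemma class_eq_word_eval:
  assumes "w \<in> words S"
  shows "word_cong S R `` {w} = word_eval (presented_group S R) (gen_class S R) w"
  using assms
proof (induction w)
  case Nil
  then show ?case by (simp add: one_presented_group)
next
  case (Cons l w)
  interpret P: group "presented_group S R" by (rule group_presented_group)
  obtain g b where l: "l = (g, b)" by (cases l)
  have g: "g \<in> S" and w: "w \<in> words S" using Cons.prems l by auto
  have "word_cong S R `` {[(g, False)]} = inv\<^bsub>presented_group S R\<^esub> gen_class S R g"
  proof (rule P.inv_equality[symmetric])
    show "word_cong S R `` {[(g, False)]} \<otimes>\<^bsub>presented_group S R\<^esub> gen_class S R g
        = \<one>\<^bsub>presented_group S R\<^esub>"
      using presented_group_mult[of "[(g, False)]" S "[(g, True)]" R] word_cong.cancel[OF g, of False R] g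
      by (simp add: gen_class_def one_presented_group equiv_class_eq[OF equiv_word_cong])
  qed (use g in \<open>auto intro: class_carrier\<close>)
  then have "word_cong S R `` {[(g, b)]}
      = (if b then gen_class S R g else inv\<^bsub>presented_group S R\<^esub> gen_class S R g)"
    by (simp add: gen_class_def)
  then show ?case
    using presented_group_mult[of "[(g, b)]" S w R] g w Cons.IH l by simp
qed

lemma relator_eq_one:
  assumes "r \<in> R" "r \<in> words S"
  shows "word_eval (presented_group S R) (gen_class S R) r = \<one>\<^bsub>presented_group S R\<^esub>"
proof -
  have "word_cong S R `` {r} = word_cong S R `` {[]}"
    by (rule equiv_class_eq[OF equiv_word_cong word_cong.relator[OF assms]])
  then show ?thesis
    using class_eq_word_eval[OF assms(2), of R] by (metis one_presented_group)
qed

lemma presented_group_cases: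
  assumes "x \<in> carrier (presented_group S R)"
  obtains w where "w \<in> words S" "x = word_eval (presented_group S R) (gen_class S R) w"
proof -
  obtain w where w: "w \<in> words S" "x = word_cong S R `` {w}"
    using assms by (auto simp: presented_group_def elim!: quotientE)
  show thesis by (rule that[OF w(1)]) (simp add: w class_eq_word_eval)
qed

lemma presented_group_induct [consumes 1, case_names one gen inv]:
  fixes S R
  defines "G \<equiv> presented_group S R"
  assumes x: "x \<in> carrier G"
    and "P \<one>\<^bsub>G\<^esub>"
    and "\<And>g x. g \<in> S \<Longrightarrow> x \<in> carrier G \<Longrightarrow> P x \<Longrightarrow> P (gen_class S R g \<otimes>\<^bsub>G\<^esub> x)"
    and "\<And>g x. g \<in> S \<Longrightarrow> x \<in> carrier G \<Longrightarrow> P x \<Longrightarrow> P (inv\<^bsub>G\<^esub> gen_class S R g \<otimes>\<^bsub>G\<^esub> x)"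
  shows "P x"
proof -
  interpret group G unfolding G_def by (rule group_presented_group)
  have gens: "gen_class S R ` S \<subseteq> carrier G" unfolding G_def by auto
  obtain w where w: "w \<in> words S" and xw: "x = word_eval G (gen_class S R) w"
    using presented_group_cases x unfolding G_def by blast
  have "P (word_eval G (gen_class S R) w)" using w
  proof (induction w)
    case (Cons l w)
    then show ?case
      using assms(4)[of "fst l" "word_eval G (gen_class S R) w"]
        assms(5)[of "fst l" "word_eval G (gen_class S R) w"] word_eval_closed[OF gens, of w]
      by (cases l) auto
  qed (simp add: assms(3))
  then show ?thesis by (simp add: xw)
qed

text \<open>Right multiplication permutes right cosets; this form of induction bounds the index of
  the image of \<open>G\<^sub>1\<close> in \<open>BS(k, k n)\<close>.\<close>

lemma presented_group_right_induct [consumes 1, case_names one gen inv]: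
  fixes S R
  defines "G \<equiv> presented_group S R"
  assumes x: "x \<in> carrier G"
    and "P \<one>\<^bsub>G\<^esub>"
    and "\<And>g x. g \<in> S \<Longrightarrow> x \<in> carrier G \<Longrightarrow> P x \<Longrightarrow> P (x \<otimes>\<^bsub>G\<^esub> gen_class S R g)"
    and "\<And>g x. g \<in> S \<Longrightarrow> x \<in> carrier G \<Longrightarrow> P x \<Longrightarrow> P (x \<otimes>\<^bsub>G\<^esub> inv\<^bsub>G\<^esub> gen_class S R g)"
  shows "P x"
proof -
  interpret group G unfolding G_def by (rule group_presented_group)
  have gens: "gen_class S R ` S \<subseteq> carrier G" unfolding G_def by auto
  obtain w where w: "w \<in> words S" and xw: "x = word_eval G (gen_class S R) w"
    using presented_group_cases x unfolding G_def by blast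
  have "P (word_eval G (gen_class S R) w)" using w
  proof (induction w rule: rev_induct)
    case (snoc l w)
    obtain g b where l: "l = (g, b)" by (cases l)
    have g: "g \<in> S" and w: "w \<in> words S" using snoc.prems l by (auto simp: words_append)
    have "word_eval G (gen_class S R) (w @ [l]) = word_eval G (gen_class S R) w
        \<otimes>\<^bsub>G\<^esub> (if b then gen_class S R g else inv\<^bsub>G\<^esub> gen_class S R g)"
      using word_eval_append[OF gens w, of "[l]"] gens g l by (auto simp: image_subset_iff)
    then show ?case
      using assms(4)[OF g word_eval_closed[OF gens w] snoc.IH[OF w]]
        assms(5)[OF g word_eval_closed[OF gens w] snoc.IH[OF w]]
      by simp
  qed (simp add: assms(3))
  then show ?thesis by (simp add: xw)
qed

lemma presented_group_hom:
  assumes "group H" "f ` S \<subseteq> carrier H"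
    and rel: "\<And>r. r \<in> R \<Longrightarrow> r \<in> words S \<Longrightarrow> word_eval H f r = \<one>\<^bsub>H\<^esub>"
  obtains \<phi> where "\<phi> \<in> hom (presented_group S R) H" "\<And>g. g \<in> S \<Longrightarrow> \<phi> (gen_class S R g) = f g"
proof -
  interpret H: group H by fact
  let ?P = "presented_group S R"
  define \<phi> where "\<phi> A = word_eval H f (SOME w. w \<in> A)" for A
  have \<phi>: "\<phi> (word_cong S R `` {w}) = word_eval H f w" if "w \<in> words S" for w
  proof -
    have "w \<in> word_cong S R `` {w}" using that by (auto intro: word_cong.refl)
    then have "(SOME w'. w' \<in> word_cong S R `` {w}) \<in> word_cong S R `` {w}" by (rule someI)
    then show ?thesis
      unfolding \<phi>_def using H.word_eval_cong[OF assms(2) rel] by force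
  qed
  show thesis
  proof
    show "\<phi> \<in> hom ?P H"
    proof (rule homI)
      fix A B assume "A \<in> carrier ?P" "B \<in> carrier ?P"
      then obtain x y where xy: "x \<in> words S" "A = word_cong S R `` {x}"
        "y \<in> words S" "B = word_cong S R `` {y}"
        by (auto simp: presented_group_def elim!: quotientE)
      then show "\<phi> (A \<otimes>\<^bsub>?P\<^esub> B) = \<phi> A \<otimes>\<^bsub>H\<^esub> \<phi> B"
        by (simp add: presented_group_mult \<phi> words_append H.word_eval_append[OF assms(2)])
      show "\<phi> A \<in> carrier H" using xy by (simp add: \<phi> H.word_eval_closed[OF assms(2)])
    qed
    show "\<phi> (gen_class S R g) = f g" if "g \<in> S" for g
    proof -
      have "f g \<in> carrier H" using that assms(2) by blast
      then show ?thesis using that by (simp add: gen_class_def \<phi>)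
    qed
  qed
qed

lemma presented_group_hom_eqI:
  assumes "\<phi> \<in> hom (presented_group S R) H" "\<psi> \<in> hom (presented_group S R) H" "group H"
    and "\<And>g. g \<in> S \<Longrightarrow> \<phi> (gen_class S R g) = \<psi> (gen_class S R g)"
    and "x \<in> carrier (presented_group S R)"
  shows "\<phi> x = \<psi> x"
proof -
  interpret \<phi>: group_hom "presented_group S R" H \<phi>
    using assms(1,3) group_presented_group by (simp add: group_hom_def group_hom_axioms_def)
  interpret \<psi>: group_hom "presented_group S R" H \<psi>
    using assms(2,3) group_presented_group by (simp add: group_hom_def group_hom_axioms_def)
  show ?thesis using assms(5)
    by (induction rule: presented_group_induct) (use assms(4) in auto)
qed

section \<open>Normal forms in multiple HNN extensions of the integers\<close>

type_synonym 'e dart = "'e \<times> bool"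
type_synonym 'e nform = "(int \<times> 'e dart) list \<times> int"

abbreviation (input) bar :: "'e dart \<Rightarrow> 'e dart" where
  "bar \<equiv> apsnd Not"

text \<open>The dart \<open>(e, True)\<close> is the stable letter \<open>t\<^sub>e\<close>, the dart \<open>(e, False)\<close> its inverse, and \<open>lam d\<close> is the label
  at the origin of \<open>d\<close>. The pair \<open>([(r\<^sub>1, d\<^sub>1), \<dots>, (r\<^sub>l, d\<^sub>l)], i)\<close> encodes the word
  \<open>a ^ r\<^sub>1 d\<^sub>1 \<dots> a ^ r\<^sub>l d\<^sub>l a ^ i\<close>; the functions \<open>act z\<close> and \<open>step d\<close> multiply it from the left by \<open>a ^ z\<close>
  and by \<open>d\<close>.\<close>

locale hnn_labels =
  fixes I :: "'e set" and lam :: "'e dart \<Rightarrow> int"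
  assumes lam_pos: "lam d > 0"
begin

definition cancels :: "'e dart \<Rightarrow> (int \<times> 'e dart) list \<Rightarrow> bool" where
  "cancels d w \<longleftrightarrow> w \<noteq> [] \<and> hd w = (0, bar d)"

text \<open>The exponent before a dart \<open>d\<close> is a chosen representative of a coset of the
  subgroup generated by \<open>a ^ lam d\<close>. This makes the normal form unique, which mere
  absence of cancellation (Britton) would not.\<close>

fun reduced :: "(int \<times> 'e dart) list \<Rightarrow> bool" where
  "reduced [] \<longleftrightarrow> True"
| "reduced ((r, d) # w) \<longleftrightarrow> 0 \<le> r \<and> r < lam d \<and> fst d \<in> I \<and> reduced w \<and> \<not> cancels d w"

definition nforms :: "'e nform set" where
  "nforms = {x. reduced (fst x)}"

text \<open>The remainder of \<open>z + r\<close> stays in front of \<open>d\<close>; the quotient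
  \<open>q\<close> passes through by
  \<open>a ^ (lam d * q) d = d a ^ (lam (bar d) * q)\<close>.\<close>

fun act_list :: "int \<Rightarrow> (int \<times> 'e dart) list \<Rightarrow> int \<Rightarrow> 'e nform" where
  "act_list z [] i = ([], z + i)"
| "act_list z ((r, d) # w) i =
    (let x = act_list (lam (bar d) * ((z + r) div lam d)) w i
     in (((z + r) mod lam d, d) # fst x, snd x))"

definition act :: "int \<Rightarrow> 'e nform \<Rightarrow> 'e nform" where
  "act z x = act_list z (fst x) (snd x)"

definition step :: "'e dart \<Rightarrow> 'e nform \<Rightarrow> 'e nform" where
  "step d x = (if cancels d (fst x) then tl (fst x) else (0, d) # fst x, snd x)"

lemma act_Nil [simp]: "act z ([], i) = ([], z + i)"
  by (simp add: act_def)

lemma act_Cons [simp]: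
  "act z ((r, d) # w, i) =
    (((z + r) mod lam d, d) # fst (act (lam (bar d) * ((z + r) div lam d)) (w, i)),
     snd (act (lam (bar d) * ((z + r) div lam d)) (w, i)))"
  by (simp add: act_def Let_def)

lemma lam_nz [simp]: "lam d \<noteq> 0"
  using lam_pos[of d] by simp

lemma act_add: "act y (act z (w, i)) = act (y + z) (w, i)"
proof (induction w arbitrary: y z)
  case (Cons a w)
  obtain r d where a: "a = (r, d)" by (cases a)
  let ?l = "lam d" and ?s = "z + r"
  have m: "(y + ?s mod ?l) mod ?l = (y + z + r) mod ?l"
    by (simp add: mod_simps algebra_simps)
  have "y + z + r = y + ?s mod ?l + ?l * (?s div ?l)"
    using mult_div_mod_eq[of ?l ?s] by linarith
  moreover have "(y + ?s mod ?l + ?l * (?s div ?l)) div ?l = ?s div ?l + (y + ?s mod ?l) div ?l"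
    by (rule div_mult_self2) simp
  ultimately have "(y + ?s mod ?l) div ?l + ?s div ?l = (y + z + r) div ?l"
    by (metis add.commute)
  then have "lam (bar d) * ((y + ?s mod ?l) div ?l) + lam (bar d) * (?s div ?l)
      = lam (bar d) * ((y + z + r) div ?l)"
    by (metis distrib_left)
  then show ?case using Cons.IH a m by simp
qed simp

lemma act_zero:
  assumes "reduced w"
  shows "act 0 (w, i) = (w, i)"
  using assms
proof (induction w)
  case (Cons a w)
  then show ?case by (cases a) simp
qed simp

lemma length_act [simp]: "length (fst (act z (w, i))) = length w"
  by (induction w arbitrary: z) (auto simp: act_def Let_def)

text \<open>Only a leading dart \<open>bar d\<close> matters, and its exponent is a residue modulo
  \<open>lam (bar d)\<close>, hence unaffected by a multiple of that label.\<close>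

lemma cancels_act:
  assumes "reduced w"
  shows "cancels d (fst (act (lam (bar d) * q) (w, i))) \<longleftrightarrow> cancels d w"
proof (cases w)
  case (Cons a w')
  obtain r d' where a: "a = (r, d')" by (cases a)
  have "(lam d' * q + r) mod lam d' = r" using assms Cons a by simp
  then have "lam d' dvd lam d' * q + r \<longleftrightarrow> r = 0" by (metis mod_eq_0_iff_dvd)
  then show ?thesis using Cons a by (auto simp: cancels_def)
qed (simp add: cancels_def)

lemma reduced_act:
  assumes "reduced w"
  shows "reduced (fst (act z (w, i)))"
  using assms
proof (induction w arbitrary: z)
  case (Cons a w)
  obtain r d where a: "a = (r, d)" by (cases a)
  show ?case using Cons a lam_pos[of d] by (simp add: cancels_act)
qed simp

lemma reduced_step: "fst d \<in> I \<Longrightarrow> reduced w \<Longrightarrow> reduced (fst (step d (w, i)))"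
  using lam_pos[of d] by (cases w) (auto simp: step_def)

lemma bar_bar [simp]: "bar (bar d) = d"
  by (cases d) simp

lemma bar_neq [simp]: "bar d \<noteq> d"
  by (cases d) simp

lemma step_bar:
  assumes "reduced w"
  shows "step (bar d) (step d (w, i)) = (w, i)"
proof (cases "cancels d w")
  case True
  then obtain w' where w: "w = (0, bar d) # w'" by (cases w) (auto simp: cancels_def)
  then show ?thesis using assms by (auto simp: step_def cancels_def)
next
  case False
  then show ?thesis by (auto simp: step_def cancels_def)
qed

text \<open>This is the HNN relation as an identity between operations on normal forms; it makes
  them an action of the presented group.\<close>

lemma step_act:
  assumes "reduced w"
  shows "step d (act (lam (bar d) * q) (w, i)) = act (lam d * q) (step d (w, i))"
proof (cases "cancels d w")
  case True
  then obtain w' where w: "w = (0, bar d) # w'" by (cases w) (auto simp: cancels_def)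
  then show ?thesis using assms by (simp add: step_def cancels_def)
next
  case False
  then show ?thesis using assms by (simp add: step_def cancels_act)
qed

end

text \<open>The same combinatorial words are evaluated in graphs with two vertices all of whose edges join
  one vertex to the other: the Boolean is the current vertex and changes with every dart.\<close>

locale typed_rep = hnn_labels I lam + H: group H
  for I :: "'e set" and lam and H (structure) +
  fixes vgen :: "bool \<Rightarrow> 'a" and cross :: "bool \<Rightarrow> 'e dart \<Rightarrow> 'a"
  assumes vgen_closed [simp]: "vgen p \<in> carrier H"
    and cross_closed [simp]: "fst d \<in> I \<Longrightarrow> cross p d \<in> carrier H"
    and cross_bar: "fst d \<in> I \<Longrightarrow> cross p d \<otimes> cross (\<not> p) (bar d) = \<one>"
    and cross_vgen: "fst d \<in> I \<Longrightarrow>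
      cross p d \<otimes> vgen (\<not> p) [^] lam (bar d) = vgen p [^] lam d \<otimes> cross p d"
begin

fun path_val :: "bool \<Rightarrow> (int \<times> 'e dart) list \<Rightarrow> int \<Rightarrow> 'a" where
  "path_val p [] i = vgen p [^] i"
| "path_val p ((r, d) # w) i = vgen p [^] r \<otimes> (cross p d \<otimes> path_val (\<not> p) w i)"

definition val :: "bool \<Rightarrow> 'e nform \<Rightarrow> 'a" where
  "val p x = path_val p (fst x) (snd x)"

lemma val_Nil [simp]: "val p ([], i) = vgen p [^] i"
  and val_Cons [simp]: "val p ((r, d) # w, i) = vgen p [^] r \<otimes> (cross p d \<otimes> val (\<not> p) (w, i))"
  by (simp_all add: val_def)

lemma val_closed [simp]: "reduced w \<Longrightarrow> val p (w, i) \<in> carrier H"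
proof (induction w arbitrary: p)
  case (Cons a w)
  then show ?case by (cases a) simp
qed simp

lemma cross_vgen_pow:
  assumes "fst d \<in> I"
  shows "cross p d \<otimes> vgen (\<not> p) [^] (lam (bar d) * q) = vgen p [^] (lam d * q) \<otimes> cross p d"
  using H.intertwine_int_pow[OF _ _ _ cross_vgen[OF assms], where z = q] assms
  by (simp add: H.int_pow_pow)

text \<open>Together with \<open>cross_val\<close> this shows that values of normal forms are closed
  under left multiplication, in every group satisfying the relations.\<close>

lemma vgen_val:
  assumes "reduced w"
  shows "vgen p [^] z \<otimes> val p (w, i) = val p (act z (w, i))"
  using assms
proof (induction w arbitrary: p z)
  case Nil
  then show ?case by (simp add: H.int_pow_mult)
next
  case (Cons a w)
  obtain r d where a: "a = (r, d)" by (cases a)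
  have d: "fst d \<in> I" and w: "reduced w" using Cons.prems a by auto
  let ?q = "(z + r) div lam d" and ?m = "(z + r) mod lam d"
  have "vgen p [^] z \<otimes> vgen p [^] r = vgen p [^] ?m \<otimes> vgen p [^] (lam d * ?q)"
    by (simp flip: H.int_pow_mult)
  then have "vgen p [^] z \<otimes> val p ((r, d) # w, i)
      = vgen p [^] ?m \<otimes> vgen p [^] (lam d * ?q) \<otimes> (cross p d \<otimes> val (\<not> p) (w, i))"
    using d w by (simp flip: H.m_assoc)
  also have "\<dots> = vgen p [^] ?m \<otimes> (vgen p [^] (lam d * ?q) \<otimes> cross p d \<otimes> val (\<not> p) (w, i))"
    using d w by (simp add: H.m_assoc)
  also have "\<dots> = vgen p [^] ?m \<otimes> (cross p d \<otimes> (vgen (\<not> p) [^] (lam (bar d) * ?q) \<otimes> val (\<not> p) (w, i)))"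
    using d w by (simp add: cross_vgen_pow[symmetric] H.m_assoc)
  also have "\<dots> = val p (act z ((r, d) # w, i))"
    using Cons.IH[OF w] by simp
  finally show ?case by (simp add: a)
qed

lemma cross_val:
  assumes "fst d \<in> I" "reduced w"
  shows "cross p d \<otimes> val (\<not> p) (w, i) = val p (step d (w, i))"
proof (cases "cancels d w")
  case True
  then obtain w' where w: "w = (0, bar d) # w'" by (cases w) (auto simp: cancels_def)
  then have "reduced w'" using assms by simp
  then show ?thesis
    using assms True cross_bar[OF assms(1)] w
    by (simp add: step_def flip: H.m_assoc)
next
  case False
  then show ?thesis using assms by (simp add: step_def)
qed

end

context hnn_labels
begin

section \<open>The HNN group and its normal form theorem\<close>

definition hnn_gens :: "'e option set" where
  "hnn_gens = insert None (Some ` I)"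

definition hnn_relator :: "'e \<Rightarrow> 'e option word" where
  "hnn_relator e = gen_pow (Some e) 1 @ gen_pow None (lam (e, False)) @
    gen_pow (Some e) (-1) @ gen_pow None (- lam (e, True))"

definition M :: "'e option word set monoid" where
  "M = presented_group hnn_gens (hnn_relator ` I)"

definition base :: "'e option word set" where
  "base = gen_class hnn_gens (hnn_relator ` I) None"

definition stable :: "'e dart \<Rightarrow> 'e option word set" where
  "stable d = (if snd d then gen_class hnn_gens (hnn_relator ` I) (Some (fst d))
    else inv\<^bsub>M\<^esub> gen_class hnn_gens (hnn_relator ` I) (Some (fst d)))"

lemma group_M: "group M"
  unfolding M_def by (rule group_presented_group)

sublocale M: group M
  by (rule group_M)

lemma base_closed [simp]: "base \<in> carrier M"
  unfolding base_def M_def by (simp add: hnn_gens_def)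

lemma gen_Some_closed: "e \<in> I \<Longrightarrow> gen_class hnn_gens (hnn_relator ` I) (Some e) \<in> carrier M"
  unfolding M_def by (simp add: hnn_gens_def)

lemma stable_closed [simp]: "fst d \<in> I \<Longrightarrow> stable d \<in> carrier M"
  unfolding stable_def using gen_Some_closed by simp

lemma stable_bar: "fst d \<in> I \<Longrightarrow> stable d \<otimes>\<^bsub>M\<^esub> stable (bar d) = \<one>\<^bsub>M\<^esub>"
  unfolding stable_def using gen_Some_closed by simp

lemma hnn_relation:
  assumes "fst d \<in> I"
  shows "stable d \<otimes>\<^bsub>M\<^esub> base [^]\<^bsub>M\<^esub> lam (bar d) = base [^]\<^bsub>M\<^esub> lam d \<otimes>\<^bsub>M\<^esub> stable d"
proof -
  let ?g = "gen_class hnn_gens (hnn_relator ` I)"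
  have "?g ` hnn_gens \<subseteq> carrier M" unfolding M_def by auto
  have "word_eval M ?g (hnn_relator e) = \<one>\<^bsub>M\<^esub>" if "e \<in> I" for e
    unfolding M_def by (rule relator_eq_one)
      (use that in \<open>auto simp: hnn_relator_def hnn_gens_def words_append\<close>)
  have T: "?g (Some e) \<otimes>\<^bsub>M\<^esub> base [^]\<^bsub>M\<^esub> lam (e, False)
      = base [^]\<^bsub>M\<^esub> lam (e, True) \<otimes>\<^bsub>M\<^esub> ?g (Some e)" if "e \<in> I" for e
  proof -
    have "Some e \<in> hnn_gens" "None \<in> hnn_gens" using that by (auto simp: hnn_gens_def)
    then show ?thesis
      using M.word_eval_edge_relator[of ?g hnn_gens "Some e" None None]
        \<open>?g ` hnn_gens \<subseteq> carrier M\<close> \<open>\<And>e. e \<in> I \<Longrightarrow> word_eval M ?g (hnn_relator e) = \<one>\<^bsub>M\<^esub>\<close>[OF that]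
      unfolding hnn_relator_def base_def by blast
  qed
  obtain e b where d: "d = (e, b)" by (cases d)
  show ?thesis
  proof (cases b)
    case True
    then show ?thesis using T[of e] assms d by (simp add: stable_def)
  next
    case False
    let ?t = "?g (Some e)" and ?x = "base [^]\<^bsub>M\<^esub> lam (e, True)" and ?y = "base [^]\<^bsub>M\<^esub> lam (e, False)"
    have c: "?t \<in> carrier M" "?x \<in> carrier M" "?y \<in> carrier M"
      using assms d gen_Some_closed by auto
    have "inv\<^bsub>M\<^esub> ?t \<otimes>\<^bsub>M\<^esub> ?x = ?y \<otimes>\<^bsub>M\<^esub> inv\<^bsub>M\<^esub> ?t"
      using T[of e] assms d c M.intertwine_inv by simp
    then show ?thesis using False d by (simp add: stable_def)
  qed
qed

text \<open>The HNN group itself is the degenerate case in which both vertices carry the same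
  generator and a dart has the same value from either side.\<close>

sublocale V: typed_rep I lam M "\<lambda>_. base" "\<lambda>_. stable"
  by unfold_locales (auto simp: stable_bar hnn_relation)

definition val :: "'e nform \<Rightarrow> 'e option word set" where
  "val x = V.val True x"

lemma val_typed: "V.val p (w, i) = val (w, i)"
proof -
  have "V.val p (w, i) = V.val q (w, i)" for q
  proof (induction w arbitrary: p q)
    case (Cons a w)
    show ?case using Cons[of "\<not> p" "\<not> q"] by (cases a) simp
  qed simp
  then show ?thesis by (simp add: val_def)
qed

lemma val_Nil [simp]: "val ([], i) = base [^]\<^bsub>M\<^esub> i"
  and val_Cons [simp]:
    "val ((r, d) # w, i) = base [^]\<^bsub>M\<^esub> r \<otimes>\<^bsub>M\<^esub> (stable d \<otimes>\<^bsub>M\<^esub> val (w, i))"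
  using val_typed[of False w i] by (simp_all add: val_def)

lemma val_closed [simp]: "reduced w \<Longrightarrow> val (w, i) \<in> carrier M"
  by (simp add: val_def)

lemma base_pow_val: "reduced w \<Longrightarrow> base [^]\<^bsub>M\<^esub> z \<otimes>\<^bsub>M\<^esub> val (w, i) = val (act z (w, i))"
  by (simp add: val_def V.vgen_val)

lemma stable_val: "fst d \<in> I \<Longrightarrow> reduced w \<Longrightarrow> stable d \<otimes>\<^bsub>M\<^esub> val (w, i) = val (step d (w, i))"
  using V.cross_val[of d w True i] val_typed[of False w i] by (simp add: val_def)

lemma val_surj:
  assumes "g \<in> carrier M"
  obtains w i where "reduced w" "g = val (w, i)"
proof -
  have "\<exists>w i. reduced w \<and> g = val (w, i)"
    using assms unfolding M_def
  proof (induction rule: presented_group_induct)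
    case one
    show ?case using M_def by (intro exI[of _ "[]"] exI[of _ 0]) simp
  next
    case (gen g x)
    then obtain w i where w: "reduced w" "x = val (w, i)" by blast
    have "\<exists>x'. reduced (fst x') \<and> gen_class hnn_gens (hnn_relator ` I) g \<otimes>\<^bsub>M\<^esub> x = val x'"
    proof (cases g)
      case None
      have "base \<otimes>\<^bsub>M\<^esub> x = val (act 1 (w, i))" using w base_pow_val[OF w(1), of 1 i] by simp
      then show ?thesis using None reduced_act[OF w(1)] unfolding base_def by blast
    next
      case (Some e)
      then have "fst (e, True) \<in> I" using gen(1) by (auto simp: hnn_gens_def)
      from stable_val[OF this w(1), of i] reduced_step[OF this w(1), of i] show ?thesis
        using Some w by (intro exI[of _ "step (e, True) (w, i)"]) (simp add: stable_def)
    qed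
    then show ?case by (auto simp: M_def)
  next
    case (inv g x)
    then obtain w i where w: "reduced w" "x = val (w, i)" by blast
    have "\<exists>x'. reduced (fst x') \<and> inv\<^bsub>M\<^esub> gen_class hnn_gens (hnn_relator ` I) g \<otimes>\<^bsub>M\<^esub> x = val x'"
    proof (cases g)
      case None
      have "inv\<^bsub>M\<^esub> base = base [^]\<^bsub>M\<^esub> (-1 :: int)" by (simp add: M.int_pow_neg)
      then have "inv\<^bsub>M\<^esub> base \<otimes>\<^bsub>M\<^esub> x = val (act (-1) (w, i))"
        using w base_pow_val[OF w(1), of "-1" i] by simp
      then show ?thesis using None reduced_act[OF w(1)] unfolding base_def by blast
    next
      case (Some e)
      then have "fst (e, False) \<in> I" using inv(1) by (auto simp: hnn_gens_def)
      from stable_val[OF this w(1), of i] reduced_step[OF this w(1), of i] show ?thesis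
        using Some w by (intro exI[of _ "step (e, False) (w, i)"]) (simp add: stable_def)
    qed
    then show ?case by (auto simp: M_def)
  qed
  then show thesis using that by blast
qed

text \<open>Van der Waerden's argument: the group acts on the set of normal forms, and \<^term>\<open>val x\<close>
  carries the trivial normal form to \<^term>\<open>x\<close>.\<close>

lemma val_inj:
  assumes "reduced (fst x)" "reduced (fst y)" "val x = val y"
  shows "x = y"
proof -
  let ?B = "BijGroup nforms"
  interpret B: group ?B by (rule group_BijGroup)
  \<comment> \<open>Elements of \<open>BijGroup\<close> are extensional functions, so the operations
    have to be made undefined off \<open>nforms\<close>.\<close>
  define \<alpha> where "\<alpha> z = restrict (act z) nforms" for z
  define \<sigma> where "\<sigma> d = restrict (step d) nforms" for d
  have mem: "(w, i) \<in> nforms \<longleftrightarrow> reduced w" for w i by (simp add: nforms_def)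
  have act_inv: "act (- z) (act z p) = p" if "p \<in> nforms" for z p
    using that by (cases p) (simp add: mem act_add act_zero)
  have act_mem: "act z p \<in> nforms" if "p \<in> nforms" for z p
    using that reduced_act by (cases p) (simp add: nforms_def)
  have step_inv: "step (bar d) (step d p) = p" if "p \<in> nforms" for d p
    using that by (cases p) (simp add: mem step_bar)
  have step_mem: "step d p \<in> nforms" if "p \<in> nforms" "fst d \<in> I" for d p
    using that reduced_step by (cases p) (simp add: nforms_def)
  have "bij_betw (act z) nforms nforms" for z
    by (rule bij_betw_byWitness[where f' = "act (- z)"])
      (use act_inv[of _ z] act_inv[of _ "- z"] act_mem in auto)
  then have \<alpha>: "\<alpha> z \<in> carrier ?B" for z by (auto simp: \<alpha>_def BijGroup_def Bij_def bij_betw_def inj_on_def)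
  have "bij_betw (step d) nforms nforms" if "fst d \<in> I" for d
    by (rule bij_betw_byWitness[where f' = "step (bar d)"])
      (use that step_inv[of _ d] step_inv[of _ "bar d"] in \<open>auto intro!: step_mem\<close>)
  then have \<sigma>: "\<sigma> d \<in> carrier ?B" if "fst d \<in> I" for d
    using that by (auto simp: \<sigma>_def BijGroup_def Bij_def bij_betw_def inj_on_def)
  have car: "carrier ?B = Bij nforms" by (simp add: BijGroup_def)
  have eqI: "f = g" if "f \<in> carrier ?B" "g \<in> carrier ?B" "\<And>p. p \<in> nforms \<Longrightarrow> f p = g p" for f g
    using that by (intro extensionalityI[of _ nforms]) (auto simp: car Bij_def)
  have app: "(f \<otimes>\<^bsub>?B\<^esub> g) p = f (g p)" if "f \<in> carrier ?B" "g \<in> carrier ?B" "p \<in> nforms" for f g p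
    using that BijGroup_apply by (simp add: car)
  have \<alpha>_pow: "\<alpha> 1 [^]\<^bsub>?B\<^esub> z = \<alpha> z" for z :: int
  proof (rule B.int_pow_of_additive[OF \<alpha>])
    show "\<alpha> (y + z) = \<alpha> y \<otimes>\<^bsub>?B\<^esub> \<alpha> z" for y z
    proof (rule eqI)
      fix p assume p: "p \<in> nforms"
      have "\<alpha> y (\<alpha> z p) = \<alpha> (y + z) p"
        using p by (cases p) (simp add: \<alpha>_def act_mem act_add)
      then show "\<alpha> (y + z) p = (\<alpha> y \<otimes>\<^bsub>?B\<^esub> \<alpha> z) p" by (simp add: app \<alpha> p)
    qed (use \<alpha> in auto)
  qed
  define f where "f = case_option (\<alpha> 1) (\<lambda>e. \<sigma> (e, True))"
  have f: "f ` hnn_gens \<subseteq> carrier ?B" using \<alpha> \<sigma> by (auto simp: f_def hnn_gens_def)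
  have "word_eval ?B f (hnn_relator e) = \<one>\<^bsub>?B\<^esub>" if e: "e \<in> I" for e
  proof -
    have "\<sigma> (e, True) \<otimes>\<^bsub>?B\<^esub> \<alpha> (lam (e, False)) = \<alpha> (lam (e, True)) \<otimes>\<^bsub>?B\<^esub> \<sigma> (e, True)"
    proof (rule eqI)
      fix p assume p: "p \<in> nforms"
      obtain w i where w: "p = (w, i)" by (cases p)
      have "\<sigma> (e, True) \<in> carrier ?B" using \<sigma> e by simp
      note eq = app[OF this \<alpha> p] app[OF \<alpha> this p]
      show "(\<sigma> (e, True) \<otimes>\<^bsub>?B\<^esub> \<alpha> (lam (e, False))) p = (\<alpha> (lam (e, True)) \<otimes>\<^bsub>?B\<^esub> \<sigma> (e, True)) p"
        unfolding eq
        using p e w step_act[of w "(e, True)" 1 i] act_mem[of p] step_mem[of p "(e, True)"]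
        by (simp add: \<alpha>_def \<sigma>_def mem)
    qed (use \<alpha> \<sigma> e in auto)
    then show ?thesis
      unfolding hnn_relator_def
      using e by (subst B.word_eval_edge_relator[OF f])
        (auto simp: hnn_gens_def f_def \<alpha>_pow)
  qed
  then obtain \<rho> where \<rho>: "\<rho> \<in> hom M ?B" "\<And>g. g \<in> hnn_gens \<Longrightarrow> \<rho> (gen_class hnn_gens (hnn_relator ` I) g) = f g"
    using presented_group_hom[OF B.is_group f, of "hnn_relator ` I"] unfolding M_def by blast
  interpret \<rho>: group_hom M ?B \<rho>
    by unfold_locales (rule \<rho>(1))
  have \<rho>_base: "\<rho> (base [^]\<^bsub>M\<^esub> z) = \<alpha> z" for z :: int
  proof -
    have "None \<in> hnn_gens" by (simp add: hnn_gens_def)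
    then have "\<rho> base = \<alpha> 1" unfolding base_def using \<rho>(2) by (simp add: f_def)
    then show ?thesis by (simp add: \<rho>.hom_int_pow \<alpha>_pow)
  qed
  have \<rho>_stable: "\<rho> (stable d) = \<sigma> d" if d: "fst d \<in> I" for d
  proof (cases "snd d")
    case True
    have gens: "Some (fst d) \<in> hnn_gens" using d by (simp add: hnn_gens_def)
    then show ?thesis
      using True \<rho>(2)[OF gens] by (cases d) (simp add: stable_def f_def)
  next
    case False
    have gens: "Some (fst d) \<in> hnn_gens" using d by (simp add: hnn_gens_def)
    have \<sigma>\<sigma>: "\<sigma> d \<in> carrier ?B" "\<sigma> (bar d) \<in> carrier ?B" using d \<sigma> by auto
    have "\<sigma> d \<otimes>\<^bsub>?B\<^esub> \<sigma> (bar d) = \<one>\<^bsub>?B\<^esub>"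
    proof (rule eqI)
      fix p assume p: "p \<in> nforms"
      have "\<sigma> d (\<sigma> (bar d) p) = p"
        using p d step_inv[of p "bar d"] step_mem[of p "bar d"] by (simp add: \<sigma>_def)
      moreover have "\<one>\<^bsub>?B\<^esub> p = p" using p by (simp add: BijGroup_def)
      ultimately show "(\<sigma> d \<otimes>\<^bsub>?B\<^esub> \<sigma> (bar d)) p = \<one>\<^bsub>?B\<^esub> p" using app[OF \<sigma>\<sigma> p] by simp
    qed (use \<sigma>\<sigma> in auto)
    then have "\<sigma> d = inv\<^bsub>?B\<^esub> \<sigma> (bar d)"
      using d \<sigma> B.inv_equality by simp
    then show ?thesis
      using False d \<rho>(2)[OF gens] gen_Some_closed
      by (cases d) (simp add: stable_def f_def)
  qed
  have "\<rho> (val (w, i)) ([], 0) = (w, i)" if "reduced w" for w i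
    using that
  proof (induction w)
    case Nil
    show ?case by (simp add: \<rho>_base \<alpha>_def mem)
  next
    case (Cons a w)
    obtain r d where a: "a = (r, d)" by (cases a)
    have d: "fst d \<in> I" and w: "reduced w" and nc: "\<not> cancels d w" using Cons.prems a by auto
    have n0: "([], 0) \<in> nforms" by (simp add: mem)
    have "\<rho> (val ((r, d) # w, i)) ([], 0) = \<alpha> r (\<sigma> d (\<rho> (val (w, i)) ([], 0)))"
      using d w n0 \<alpha> \<sigma> Cons.IH[OF w] by (simp add: \<rho>_base \<rho>_stable app mem)
    also have "\<dots> = (a # w, i)"
      using Cons.prems d w nc Cons.IH[OF w] a
      by (simp add: \<alpha>_def \<sigma>_def mem step_def act_zero lam_pos)
    finally show ?case by (simp add: a)
  qed
  then show ?thesis using assms by (metis prod.collapse)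
qed

definition nf :: "'e option word set \<Rightarrow> 'e nform" where
  "nf g = (THE x. reduced (fst x) \<and> val x = g)"

lemma nf_val: "reduced w \<Longrightarrow> nf (val (w, i)) = (w, i)"
  unfolding nf_def using val_inj by (intro the_equality) auto

lemma nf_cases:
  assumes "g \<in> carrier M"
  obtains w i where "reduced w" "g = val (w, i)" "nf g = (w, i)"
  using val_surj[OF assms] nf_val by metis

lemma nf_base_pow:
  assumes "g \<in> carrier M"
  shows "nf (base [^]\<^bsub>M\<^esub> z \<otimes>\<^bsub>M\<^esub> g) = act z (nf g)"
proof -
  obtain w i where w: "reduced w" "g = val (w, i)" "nf g = (w, i)" using nf_cases[OF assms] .
  show ?thesis
    using w nf_val[OF reduced_act[OF w(1)], of z i "snd (act z (w, i))"] by (simp add: base_pow_val)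
qed

lemma nf_stable:
  assumes "g \<in> carrier M" "fst d \<in> I"
  shows "nf (stable d \<otimes>\<^bsub>M\<^esub> g) = step d (nf g)"
proof -
  obtain w i where w: "reduced w" "g = val (w, i)" "nf g = (w, i)" using nf_cases[OF assms(1)] .
  show ?thesis
    using w assms nf_val[OF reduced_step[OF assms(2) w(1)], of i "snd (step d (w, i))"]
    by (simp add: stable_val)
qed

lemma val_mult_base_pow:
  "reduced w \<Longrightarrow> val (w, i) \<otimes>\<^bsub>M\<^esub> base [^]\<^bsub>M\<^esub> z = val (w, i + z)"
proof (induction w)
  case (Cons a w)
  then show ?case by (cases a) (simp add: M.m_assoc)
qed (simp add: M.int_pow_mult)

section \<open>Length of normal forms and cyclic reduction\<close>

definition len :: "'e option word set \<Rightarrow> nat" where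
  "len g = length (fst (nf g))"

lemma length_step: "length (fst (step d x)) \<le> Suc (length (fst x))"
  by (cases "fst x") (auto simp: step_def)

lemma len_mult:
  assumes "g \<in> carrier M" "h \<in> carrier M"
  shows "len (g \<otimes>\<^bsub>M\<^esub> h) \<le> len g + len h"
proof -
  obtain w i where w: "reduced w" "g = val (w, i)" "nf g = (w, i)" using nf_cases[OF assms(1)] .
  have len_act: "length (fst (act z x)) = length (fst x)" for z x by (cases x) simp
  have "len (val (w, i) \<otimes>\<^bsub>M\<^esub> h) \<le> length w + len h"
    using w(1)
  proof (induction w)
    case Nil
    then show ?case using assms(2) by (simp add: len_def nf_base_pow len_act)
  next
    case (Cons a w)
    obtain r d where a: "a = (r, d)" by (cases a)
    have d: "fst d \<in> I" and w: "reduced w" using Cons.prems a by auto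
    let ?x = "nf (val (w, i) \<otimes>\<^bsub>M\<^esub> h)"
    have "len (val (a # w, i) \<otimes>\<^bsub>M\<^esub> h) = length (fst (act r (step d ?x)))"
      using a d w assms(2) by (simp add: M.m_assoc len_def nf_base_pow nf_stable)
    also have "\<dots> \<le> Suc (length (fst ?x))" by (simp add: len_act length_step)
    finally show ?case using Cons.IH[OF w] by (simp add: len_def)
  qed
  then show ?thesis using w by (simp add: len_def)
qed

text \<open>The last condition forbids cancellation at the seam of \<open>val x\<close> multiplied
  by itself. The exponent \<open>0\<close> is a placeholder, since only the first entry of the list
  is inspected.\<close>

definition cyc_reduced :: "'e nform \<Rightarrow> bool" where
  "cyc_reduced x \<longleftrightarrow> reduced (fst x) \<and> fst x \<noteq> [] \<and>
    \<not> cancels (snd (last (fst x))) (fst (act (snd x) (fst x, 0)))"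

lemma cancels_act_append:
  "w \<noteq> [] \<Longrightarrow> cancels d (fst (act i (w @ v, j))) \<longleftrightarrow> cancels d (fst (act i (w, k)))"
  by (cases w) (auto simp: cancels_def)

lemma nf_mult_no_cancel:
  assumes "reduced w" "w \<noteq> []" "h \<in> carrier M"
    and "\<not> cancels (snd (last w)) (fst (act i (nf h)))"
  shows "nf (val (w, i) \<otimes>\<^bsub>M\<^esub> h) = (w @ fst (act i (nf h)), snd (act i (nf h)))"
proof -
  let ?x = "act i (nf h)"
  obtain v j where v: "reduced v" "nf h = (v, j)" using nf_cases[OF assms(3)] by metis
  then have red: "reduced (fst ?x)" using reduced_act by simp
  have main: "nf (val (w, i) \<otimes>\<^bsub>M\<^esub> h) = (w @ fst ?x, snd ?x) \<and> reduced (w @ fst ?x)"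
    if "reduced w" "w \<noteq> []" "\<not> cancels (snd (last w)) (fst ?x)" for w
    using that
  proof (induction w)
    case (Cons a w)
    obtain r d where a: "a = (r, d)" by (cases a)
    have d: "fst d \<in> I" and w: "reduced w" and r: "0 \<le> r" "r < lam d"
      and nc: "\<not> cancels d w" using Cons.prems a by auto
    let ?y = "nf (val (w, i) \<otimes>\<^bsub>M\<^esub> h)"
    have y: "?y = (w @ fst ?x, snd ?x) \<and> reduced (w @ fst ?x) \<and> \<not> cancels d (w @ fst ?x)"
    proof (cases "w = []")
      case True
      then show ?thesis using Cons.prems a assms(3) red by (simp add: nf_base_pow)
    next
      case False
      then show ?thesis using Cons nc w by (simp add: cancels_def)
    qed
    have "nf (val (a # w, i) \<otimes>\<^bsub>M\<^esub> h) = act r (step d ?y)"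
      using a d w assms(3) by (simp add: M.m_assoc nf_base_pow nf_stable)
    also have "\<dots> = (a # w @ fst ?x, snd ?x)"
      using y r a by (simp add: step_def act_zero)
    finally show ?case using y r d a by simp
  qed simp
  show ?thesis using main[of w] assms by blast
qed

text \<open>The prefix \<open>w\<close> is recorded besides the length: the seam condition sees only
  the first entry, so the prefix carries the induction. It also tells later with which dart a power
  of \<open>turn\<close> begins.\<close>

lemma nf_cyc_reduced_pow:
  assumes "cyc_reduced (w, i)"
  shows "\<exists>v j. nf (val (w, i) [^]\<^bsub>M\<^esub> Suc m) = (w @ v, j) \<and> length (w @ v) = Suc m * length w"
proof (induction m)
  case 0
  then show ?case using assms nf_val[of w i] by (simp add: cyc_reduced_def)
next
  case (Suc m)
  have w: "reduced w" "w \<noteq> []" "\<not> cancels (snd (last w)) (fst (act i (w, 0)))"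
    using assms by (auto simp: cyc_reduced_def)
  let ?g = "val (w, i)"
  obtain v j where v: "nf (?g [^]\<^bsub>M\<^esub> Suc m) = (w @ v, j)" "length (w @ v) = Suc m * length w"
    using Suc.IH by blast
  have "?g \<in> carrier M" using w by simp
  then have "?g [^]\<^bsub>M\<^esub> Suc (Suc m) = ?g \<otimes>\<^bsub>M\<^esub> ?g [^]\<^bsub>M\<^esub> Suc m" "?g [^]\<^bsub>M\<^esub> Suc m \<in> carrier M"
    by (metis M.nat_pow_Suc2, simp)
  moreover have "\<not> cancels (snd (last w)) (fst (act i (nf (?g [^]\<^bsub>M\<^esub> Suc m))))"
    using w v cancels_act_append[OF w(2)] by metis
  ultimately have "nf (?g [^]\<^bsub>M\<^esub> Suc (Suc m)) = (w @ fst (act i (w @ v, j)), snd (act i (w @ v, j)))"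
    using nf_mult_no_cancel[OF w(1,2)] v(1) by metis
  moreover have "length (w @ fst (act i (w @ v, j))) = Suc (Suc m) * length w"
    using v(2) by simp
  ultimately show ?case by blast
qed

lemma len_cyc_reduced_pow:
  assumes "cyc_reduced (w, i)"
  shows "m \<le> len (val (w, i) [^]\<^bsub>M\<^esub> m)"
proof (cases m)
  case (Suc j)
  have "length w \<ge> 1" using assms by (cases w) (auto simp: cyc_reduced_def)
  then have "m \<le> m * length w" by simp
  then show ?thesis using nf_cyc_reduced_pow[OF assms, of j] Suc by (auto simp: len_def)
qed simp

lemma reduced_append: "reduced (u @ v) \<Longrightarrow> reduced u \<and> reduced v"
proof (induction u)
  case (Cons a u)
  then show ?case by (cases a) (auto simp: cancels_def)
qed simp

lemma val_snoc:
  assumes "reduced (w @ [(r, d)])"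
  shows "val (w @ [(r, d)], i) = val (w, r) \<otimes>\<^bsub>M\<^esub> stable d \<otimes>\<^bsub>M\<^esub> base [^]\<^bsub>M\<^esub> i"
  using assms
proof (induction w)
  case (Cons a w)
  have "reduced w" "fst d \<in> I" using reduced_append[OF Cons.prems] by (cases a, simp)+
  with Cons show ?case by (cases a) (simp add: M.m_assoc)
qed (simp add: M.m_assoc)

text \<open>If the last dart cancels against the first one, conjugating by the first syllable
  \<open>a ^ r d\<close> removes both darts, and the length drops by two.\<close>

lemma ex_cyc_reduced_conj:
  assumes "g \<in> carrier M"
  obtains h w i where "h \<in> carrier M" "g = h \<otimes>\<^bsub>M\<^esub> val (w, i) \<otimes>\<^bsub>M\<^esub> inv\<^bsub>M\<^esub> h"
    "w = [] \<or> cyc_reduced (w, i)"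
proof -
  have "\<exists>h w i. h \<in> carrier M \<and> g = h \<otimes>\<^bsub>M\<^esub> val (w, i) \<otimes>\<^bsub>M\<^esub> inv\<^bsub>M\<^esub> h
      \<and> (w = [] \<or> cyc_reduced (w, i))"
    using assms
  proof (induction "len g" arbitrary: g rule: less_induct)
    case less
    obtain w i where w: "reduced w" "g = val (w, i)" "nf g = (w, i)" using nf_cases[OF less.prems] .
    show ?case
    proof (cases "w = [] \<or> cyc_reduced (w, i)")
      case True
      then show ?thesis using w less.prems
        by (intro exI[of _ "\<one>\<^bsub>M\<^esub>"] exI[of _ w] exI[of _ i]) simp
    next
      case False
      then obtain r d w1 where w1: "w = (r, d) # w1" by (cases w) auto
      have d: "fst d \<in> I" and rw1: "reduced w1" using w w1 by auto
      have can: "cancels (snd (last w)) (fst (act i (w, 0)))"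
        using False w(1) by (auto simp: cyc_reduced_def)
      then have div: "lam d dvd i + r" and last: "d = bar (snd (last w))"
        using w1 by (auto simp: cancels_def)
      \<comment> \<open>In a word with a single dart, that dart would have to be its own
        inverse.\<close>
      have "w1 \<noteq> []" using last w1 bar_neq[of d] by (metis last.simps snd_conv)
      then obtain w2 r2 where w2: "w1 = w2 @ [(r2, bar d)]"
        using last w1 by (metis append_butlast_last_id bar_bar last_ConsR prod.collapse)
      obtain q where q: "i + r = lam d * q" using div by blast
      let ?p = "base [^]\<^bsub>M\<^esub> r \<otimes>\<^bsub>M\<^esub> stable d"
      let ?g' = "val (w2, r2 + lam (bar d) * q)"
      have p: "?p \<in> carrier M" using d by simp
      have rw2: "reduced w2" using rw1 w2 reduced_append by blast
      have "g \<otimes>\<^bsub>M\<^esub> ?p = ?p \<otimes>\<^bsub>M\<^esub> (val (w1, i) \<otimes>\<^bsub>M\<^esub> base [^]\<^bsub>M\<^esub> r \<otimes>\<^bsub>M\<^esub> stable d)"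
        using w w1 d rw1 by (simp add: M.m_assoc)
      also have "val (w1, i) \<otimes>\<^bsub>M\<^esub> base [^]\<^bsub>M\<^esub> r \<otimes>\<^bsub>M\<^esub> stable d
          = val (w2, r2) \<otimes>\<^bsub>M\<^esub> (stable (bar d) \<otimes>\<^bsub>M\<^esub> base [^]\<^bsub>M\<^esub> (lam d * q)) \<otimes>\<^bsub>M\<^esub> stable d"
        using val_mult_base_pow[OF rw1] val_snoc[of w2 r2 "bar d"] rw1 w2 q rw2 d
        by (simp add: M.m_assoc)
      also have "stable (bar d) \<otimes>\<^bsub>M\<^esub> base [^]\<^bsub>M\<^esub> (lam d * q)
          = base [^]\<^bsub>M\<^esub> (lam (bar d) * q) \<otimes>\<^bsub>M\<^esub> stable (bar d)"
        using V.cross_vgen_pow[of "bar d" q] d by simp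
      also have "val (w2, r2) \<otimes>\<^bsub>M\<^esub> (base [^]\<^bsub>M\<^esub> (lam (bar d) * q) \<otimes>\<^bsub>M\<^esub> stable (bar d)) \<otimes>\<^bsub>M\<^esub> stable d
          = ?g'"
        using stable_bar[of "bar d"] d rw2 by (simp add: M.m_assoc val_mult_base_pow)
      finally have gp: "g \<otimes>\<^bsub>M\<^esub> ?p = ?p \<otimes>\<^bsub>M\<^esub> ?g'" .
      have "len ?g' < len g" using w w1 w2 rw2 nf_val[OF rw2] by (simp add: len_def)
      then obtain h v j where h: "h \<in> carrier M" "?g' = h \<otimes>\<^bsub>M\<^esub> val (v, j) \<otimes>\<^bsub>M\<^esub> inv\<^bsub>M\<^esub> h"
        "v = [] \<or> cyc_reduced (v, j)"
        using less.hyps[of ?g'] rw2 by auto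
      then have vj: "val (v, j) \<in> carrier M" by (auto simp: cyc_reduced_def)
      have "g = ?p \<otimes>\<^bsub>M\<^esub> ?g' \<otimes>\<^bsub>M\<^esub> inv\<^bsub>M\<^esub> ?p"
        using gp p rw2 less.prems by (metis M.inv_solve_right val_closed M.m_closed)
      also have "\<dots> = (?p \<otimes>\<^bsub>M\<^esub> h) \<otimes>\<^bsub>M\<^esub> val (v, j) \<otimes>\<^bsub>M\<^esub> inv\<^bsub>M\<^esub> (?p \<otimes>\<^bsub>M\<^esub> h)"
        unfolding h(2) using p h(1) vj by (simp only: M.m_assoc M.inv_mult_group M.m_closed M.inv_closed)
      finally show ?thesis using h p by (intro exI[of _ "?p \<otimes>\<^bsub>M\<^esub> h"]) auto
    qed
  qed
  then show thesis using that by blast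
qed

text \<open>The translation length of a \<open>j\<close>-th power is at least \<open>j\<close> unless the root is elliptic.\<close>

lemma elliptic_if_unbounded_roots:
  assumes c: "c \<in> carrier M"
    and roots: "\<And>N. \<exists>r\<in>carrier M. \<exists>j>N. c = r [^]\<^bsub>M\<^esub> (j :: nat)"
  obtains h z where "h \<in> carrier M" "c = h \<otimes>\<^bsub>M\<^esub> base [^]\<^bsub>M\<^esub> (z :: int) \<otimes>\<^bsub>M\<^esub> inv\<^bsub>M\<^esub> h"
proof -
  obtain r j where r: "r \<in> carrier M" "len c < j" "c = r [^]\<^bsub>M\<^esub> j" using roots by blast
  obtain h w i where h: "h \<in> carrier M" "r = h \<otimes>\<^bsub>M\<^esub> val (w, i) \<otimes>\<^bsub>M\<^esub> inv\<^bsub>M\<^esub> h"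
    "w = [] \<or> cyc_reduced (w, i)" using ex_cyc_reduced_conj[OF r(1)] .
  let ?s = "val (w, i)"
  have s: "?s \<in> carrier M" using h(3) by (auto simp: cyc_reduced_def)
  have c_eq: "c = h \<otimes>\<^bsub>M\<^esub> ?s [^]\<^bsub>M\<^esub> j \<otimes>\<^bsub>M\<^esub> inv\<^bsub>M\<^esub> h" using r h s by (simp add: M.conj_nat_pow)
  show thesis
  proof (cases "w = []")
    case True
    have "(base [^]\<^bsub>M\<^esub> i) [^]\<^bsub>M\<^esub> j = base [^]\<^bsub>M\<^esub> (i * int j)"
      using M.int_pow_pow[of base i "int j"] int_pow_int[of M "base [^]\<^bsub>M\<^esub> i" j] by simp
    then show thesis using that[OF h(1), of "i * int j"] c_eq True by simp
  next
    case False
    then have cyc: "cyc_reduced (w, i)" using h by blast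
    \<comment> \<open>Conjugation by \<open>h\<close> changes \<open>len\<close> by at most
      \<open>len (inv h) + len h\<close>. Comparing \<open>?p\<close>-th powers, with
      \<open>?p\<close> above this error, leaves less than \<open>1\<close> after division by
      \<open>?p\<close>, so that \<open>j < len c + 1\<close>.\<close>
    let ?p = "Suc (len (inv\<^bsub>M\<^esub> h) + len h)"
    have "len (c [^]\<^bsub>M\<^esub> p) \<le> p * len c" for p :: nat
    proof (induction p)
      case 0
      have "nf \<one>\<^bsub>M\<^esub> = ([], 0)" using nf_val[of "[]" 0] by simp
      then show ?case by (simp add: len_def)
    next
      case (Suc p)
      then show ?case using len_mult[of "c [^]\<^bsub>M\<^esub> p" c] c by simp
    qed
    then have le: "len (c [^]\<^bsub>M\<^esub> ?p) \<le> ?p * len c" .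
    have cp: "c [^]\<^bsub>M\<^esub> ?p = h \<otimes>\<^bsub>M\<^esub> ?s [^]\<^bsub>M\<^esub> (j * ?p) \<otimes>\<^bsub>M\<^esub> inv\<^bsub>M\<^esub> h"
      unfolding c_eq using h(1) s by (simp only: M.conj_nat_pow M.nat_pow_closed M.nat_pow_pow)
    have "?s [^]\<^bsub>M\<^esub> (j * ?p) = inv\<^bsub>M\<^esub> h \<otimes>\<^bsub>M\<^esub> (c [^]\<^bsub>M\<^esub> ?p \<otimes>\<^bsub>M\<^esub> h)"
    proof -
      define x where "x = ?s [^]\<^bsub>M\<^esub> (j * ?p)"
      have x: "x \<in> carrier M" unfolding x_def using s by (rule M.nat_pow_closed)
      have "inv\<^bsub>M\<^esub> h \<otimes>\<^bsub>M\<^esub> (h \<otimes>\<^bsub>M\<^esub> x \<otimes>\<^bsub>M\<^esub> inv\<^bsub>M\<^esub> h \<otimes>\<^bsub>M\<^esub> h) = x"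
        using h(1) x M.l_inv[OF h(1)] by (simp add: M.m_assoc) (simp flip: M.m_assoc)
      then show ?thesis unfolding cp x_def by (simp only:)
    qed
    then have "j * ?p \<le> len (inv\<^bsub>M\<^esub> h \<otimes>\<^bsub>M\<^esub> (c [^]\<^bsub>M\<^esub> ?p \<otimes>\<^bsub>M\<^esub> h))"
      using len_cyc_reduced_pow[OF cyc, of "j * ?p"] by metis
    also have "\<dots> \<le> len (inv\<^bsub>M\<^esub> h) + (len (c [^]\<^bsub>M\<^esub> ?p) + len h)"
      by (rule order_trans[OF len_mult add_left_mono[OF len_mult]]) (use c h(1) in auto)
    also have "\<dots> < ?p * len c + ?p" using le by linarith
    also have "\<dots> = (len c + 1) * ?p" by (simp only: distrib_right mult.commute mult_1)
    finally have "j < len c + 1" by (metis mult_less_cancel2)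
    then show thesis using r by simp
  qed
qed

text \<open>In terms of the Bass--Serre tree: \<open>a ^ z\<close> fixes the path \<open>w\<close>
  and is seen as \<open>a ^ z'\<close> from its far end. The exponents \<open>r\<close> are ignored
  because powers of \<open>a\<close> commute with each other.\<close>

fun conveys :: "int \<Rightarrow> (int \<times> 'e dart) list \<Rightarrow> int \<Rightarrow> bool" where
  "conveys z [] z' \<longleftrightarrow> z = z'"
| "conveys z ((r, d) # w) z' \<longleftrightarrow> lam d dvd z \<and> conveys (lam (bar d) * (z div lam d)) w z'"

lemma act_eq_iff_conveys:
  "reduced w \<Longrightarrow> act z (w, i) = (w, i + z') \<longleftrightarrow> conveys z w z'"
proof (induction w arbitrary: z)
  case (Cons a w)
  obtain r d where a: "a = (r, d)" by (cases a)
  have r: "0 \<le> r" "r < lam d" and w: "reduced w" using Cons.prems a by auto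
  have dvd: "(z + r) mod lam d = r \<longleftrightarrow> lam d dvd z"
    using r by (metis add.commute add_diff_cancel_left' mod_eq_dvd_iff mod_pos_pos_trivial)
  show ?case
  proof (cases "lam d dvd z")
    case True
    then have "(z + r) div lam d = z div lam d" using r by auto
    then show ?thesis
      using Cons.IH[OF w, of "lam (bar d) * (z div lam d)"] True dvd
      by (simp add: a prod_eq_iff)
  qed (use dvd in \<open>simp add: a\<close>)
qed auto

lemma commutes_base_pow_iff:
  assumes "reduced w"
  shows "base [^]\<^bsub>M\<^esub> z \<otimes>\<^bsub>M\<^esub> val (w, i) = val (w, i) \<otimes>\<^bsub>M\<^esub> base [^]\<^bsub>M\<^esub> z
    \<longleftrightarrow> conveys z w z"
proof -
  have "base [^]\<^bsub>M\<^esub> z \<otimes>\<^bsub>M\<^esub> val (w, i) = val (w, i) \<otimes>\<^bsub>M\<^esub> base [^]\<^bsub>M\<^esub> z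
      \<longleftrightarrow> act z (w, i) = (w, i + z)"
    using assms val_inj[of "act z (w, i)" "(w, i + z)"] reduced_act[OF assms]
    by (auto simp: base_pow_val val_mult_base_pow)
  then show ?thesis using act_eq_iff_conveys[OF assms] by simp
qed

lemma hnn_hom:
  assumes "group H" "a \<in> carrier H" "\<And>e. e \<in> I \<Longrightarrow> t e \<in> carrier H"
    and rel: "\<And>e. e \<in> I \<Longrightarrow> t e \<otimes>\<^bsub>H\<^esub> a [^]\<^bsub>H\<^esub> lam (e, False) = a [^]\<^bsub>H\<^esub> lam (e, True) \<otimes>\<^bsub>H\<^esub> t e"
  shows "\<exists>\<phi>\<in>hom M H. \<phi> base = a \<and> (\<forall>e\<in>I. \<phi> (stable (e, True)) = t e)"
proof -
  interpret H: group H by fact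
  let ?f = "case_option a t"
  have f: "?f ` hnn_gens \<subseteq> carrier H" using assms(2,3) by (auto simp: hnn_gens_def)
  have "word_eval H ?f (hnn_relator e) = \<one>\<^bsub>H\<^esub>" if "e \<in> I" for e
    unfolding hnn_relator_def using that rel
    by (subst H.word_eval_edge_relator[OF f]) (auto simp: hnn_gens_def)
  then obtain \<phi> where "\<phi> \<in> hom M H"
    "\<And>g. g \<in> hnn_gens \<Longrightarrow> \<phi> (gen_class hnn_gens (hnn_relator ` I) g) = ?f g"
    using presented_group_hom[OF assms(1) f, of "hnn_relator ` I"] unfolding M_def by blast
  then show ?thesis
    by (intro bexI[of _ \<phi>]) (auto simp: base_def stable_def hnn_gens_def)
qed

end

section \<open>Graphs of groups with two vertices\<close>

context
  fixes ls :: "(int \<times> int) list"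
begin

definition tv_gens :: "(vertex, nat) generator set" where
  "tv_gens = range Vertex_Gen \<union> Edge_Gen ` {..<length ls}"

definition tv_relators :: "(vertex, nat) generator word set" where
  "tv_relators = edge_relator (two_vertex_graph ls) ` {..<length ls} \<union> {gen_pow (Edge_Gen 0) 1}"

definition tv_gen :: "(vertex, nat) generator \<Rightarrow> (vertex, nat) generator word set" where
  "tv_gen = gen_class tv_gens tv_relators"

definition tv_group :: "(vertex, nat) generator word set monoid" where
  "tv_group = presented_group tv_gens tv_relators"

lemma group_tv_group: "group tv_group"
  unfolding tv_group_def by (rule group_presented_group)

lemma fundamental_group_two_vertex_graph:
  "fundamental_group (two_vertex_graph ls) {0} = tv_group"
proof -
  have "{V, U} = UNIV" using vertex.exhaust by blast
  then have "Vertex_Gen ` verts (two_vertex_graph ls) \<union> Edge_Gen ` arcs (two_vertex_graph ls) = tv_gens"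
    by (simp add: tv_gens_def two_vertex_graph_def)
  then show ?thesis
    by (simp add: fundamental_group_def tv_group_def tv_relators_def two_vertex_graph_def)
qed

lemma tv_edge_relator:
  "edge_relator (two_vertex_graph ls) e =
    gen_pow (Edge_Gen e) 1 @ gen_pow (Vertex_Gen U) (snd (ls ! e)) @
    gen_pow (Edge_Gen e) (-1) @ gen_pow (Vertex_Gen V) (- fst (ls ! e))"
  by (simp add: edge_relator_def two_vertex_graph_def)

lemma tv_mem:
  "Vertex_Gen p \<in> tv_gens" "e < length ls \<Longrightarrow> Edge_Gen e \<in> tv_gens"
  by (auto simp: tv_gens_def)

lemma tv_gen_closed:
  "tv_gen (Vertex_Gen p) \<in> carrier tv_group" "e < length ls \<Longrightarrow> tv_gen (Edge_Gen e) \<in> carrier tv_group"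
  by (simp_all add: tv_gen_def tv_group_def tv_mem)

lemma tv_gens_closed: "tv_gen ` tv_gens \<subseteq> carrier tv_group"
  by (auto simp: tv_gen_def tv_group_def)

lemma tv_relation:
  assumes "e < length ls"
  shows "tv_gen (Edge_Gen e) \<otimes>\<^bsub>tv_group\<^esub> tv_gen (Vertex_Gen U) [^]\<^bsub>tv_group\<^esub> snd (ls ! e)
    = tv_gen (Vertex_Gen V) [^]\<^bsub>tv_group\<^esub> fst (ls ! e) \<otimes>\<^bsub>tv_group\<^esub> tv_gen (Edge_Gen e)"
proof -
  interpret group tv_group by (rule group_tv_group)
  have "word_eval tv_group tv_gen (edge_relator (two_vertex_graph ls) e) = \<one>\<^bsub>tv_group\<^esub>"
    unfolding tv_group_def tv_gen_def
  proof (rule relator_eq_one)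
    show "edge_relator (two_vertex_graph ls) e \<in> tv_relators"
      using assms by (simp add: tv_relators_def)
    show "edge_relator (two_vertex_graph ls) e \<in> words tv_gens"
      using assms by (simp add: tv_edge_relator words_append tv_mem)
  qed
  then show ?thesis
    unfolding tv_edge_relator
    using word_eval_edge_relator[OF tv_gens_closed] assms tv_mem by blast
qed

lemma tv_tree_gen:
  assumes "ls \<noteq> []"
  shows "tv_gen (Edge_Gen 0) = \<one>\<^bsub>tv_group\<^esub>"
proof -
  interpret group tv_group by (rule group_tv_group)
  have 0: "0 < length ls" using assms by simp
  have "word_eval tv_group tv_gen (gen_pow (Edge_Gen 0) 1) = \<one>\<^bsub>tv_group\<^esub>"
    unfolding tv_group_def tv_gen_def
    by (rule relator_eq_one) (use tv_mem(2)[OF 0] in \<open>auto simp: tv_relators_def\<close>)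
  then show ?thesis using tv_gen_closed(2)[OF 0] by (simp add: word_eval_gen_pow)
qed

lemma tv_hom:
  assumes "group H" "v \<in> carrier H" "u \<in> carrier H" "\<And>e. e < length ls \<Longrightarrow> t e \<in> carrier H"
    and "t 0 = \<one>\<^bsub>H\<^esub>" "ls \<noteq> []"
    and rel: "\<And>e. e < length ls \<Longrightarrow>
      t e \<otimes>\<^bsub>H\<^esub> u [^]\<^bsub>H\<^esub> snd (ls ! e) = v [^]\<^bsub>H\<^esub> fst (ls ! e) \<otimes>\<^bsub>H\<^esub> t e"
  shows "\<exists>\<phi>\<in>hom tv_group H. \<phi> (tv_gen (Vertex_Gen V)) = v \<and> \<phi> (tv_gen (Vertex_Gen U)) = u \<and>
    (\<forall>e<length ls. \<phi> (tv_gen (Edge_Gen e)) = t e)"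
proof -
  interpret H: group H by fact
  let ?f = "case_generator (case_vertex v u) t"
  have f: "?f ` tv_gens \<subseteq> carrier H"
    using assms(2-4) by (auto simp: tv_gens_def split: vertex.splits)
  have "word_eval H ?f r = \<one>\<^bsub>H\<^esub>" if r: "r \<in> tv_relators" for r
  proof -
    consider e where "e < length ls" "r = edge_relator (two_vertex_graph ls) e"
      | "r = gen_pow (Edge_Gen 0) 1"
      using r by (auto simp: tv_relators_def)
    then show ?thesis
    proof cases
      case 1
      then show ?thesis
        using rel[OF 1(1)] H.word_eval_edge_relator[OF f, of "Edge_Gen e" "Vertex_Gen U" "Vertex_Gen V"]
        by (simp add: tv_edge_relator tv_mem)
    next
      case 2
      then show ?thesis using assms(5) by (simp add: H.word_eval_gen_pow)
    qed
  qed
  then obtain \<phi> where \<phi>: "\<phi> \<in> hom tv_group H" "\<And>g. g \<in> tv_gens \<Longrightarrow> \<phi> (tv_gen g) = ?f g"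
    using presented_group_hom[OF assms(1) f, of tv_relators] unfolding tv_group_def tv_gen_def by blast
  show ?thesis by (intro bexI[OF _ \<phi>(1)]) (simp add: \<phi>(2) tv_mem)
qed

end

text \<open>An algebraic form of the statement that some elliptic element \<open>b\<close> has the same centralizer as
  its \<open>n\<close>-th power, up to replacing \<open>b\<close> by \<open>b ^ k\<close>; the element \<open>s\<close> forces \<open>b\<close> to be elliptic.\<close>

definition centralizer_stable :: "nat \<Rightarrow> nat \<Rightarrow> ('a, 'b) monoid_scheme \<Rightarrow> bool" where
  "centralizer_stable k n G \<longleftrightarrow> (\<exists>b\<in>carrier G. \<exists>s\<in>carrier G. \<exists>N::nat. N \<ge> 2 \<and> b \<noteq> \<one>\<^bsub>G\<^esub> \<and>
    s \<otimes>\<^bsub>G\<^esub> b [^]\<^bsub>G\<^esub> N = b \<otimes>\<^bsub>G\<^esub> s \<and>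
    (\<forall>g\<in>carrier G. g \<otimes>\<^bsub>G\<^esub> b [^]\<^bsub>G\<^esub> (k * n) = b [^]\<^bsub>G\<^esub> (k * n) \<otimes>\<^bsub>G\<^esub> g \<longrightarrow>
      g \<otimes>\<^bsub>G\<^esub> b [^]\<^bsub>G\<^esub> k = b [^]\<^bsub>G\<^esub> k \<otimes>\<^bsub>G\<^esub> g))"

lemma centralizer_stable_iso:
  assumes "G \<cong> H" "group G" "group H" "centralizer_stable k n G"
  shows "centralizer_stable k n H"
proof -
  obtain f where f: "f \<in> iso G H" using assms(1) by (auto simp: is_iso_def)
  interpret f: group_hom G H f
    using f assms(2,3) by (simp add: group_hom_def group_hom_axioms_def iso_def)
  have inj: "inj_on f (carrier G)" and surj: "f ` carrier G = carrier H"
    using f by (auto simp: iso_def bij_betw_def)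
  obtain b s N where b: "b \<in> carrier G" "s \<in> carrier G" "(N::nat) \<ge> 2" "b \<noteq> \<one>\<^bsub>G\<^esub>"
    "s \<otimes>\<^bsub>G\<^esub> b [^]\<^bsub>G\<^esub> N = b \<otimes>\<^bsub>G\<^esub> s"
    and cen: "\<And>g. g \<in> carrier G \<Longrightarrow> g \<otimes>\<^bsub>G\<^esub> b [^]\<^bsub>G\<^esub> (k * n) = b [^]\<^bsub>G\<^esub> (k * n) \<otimes>\<^bsub>G\<^esub> g \<Longrightarrow>
      g \<otimes>\<^bsub>G\<^esub> b [^]\<^bsub>G\<^esub> k = b [^]\<^bsub>G\<^esub> k \<otimes>\<^bsub>G\<^esub> g"
    using assms(4) unfolding centralizer_stable_def by blast
  have comm: "f g \<otimes>\<^bsub>H\<^esub> f b [^]\<^bsub>H\<^esub> j = f b [^]\<^bsub>H\<^esub> j \<otimes>\<^bsub>H\<^esub> f g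
      \<longleftrightarrow> g \<otimes>\<^bsub>G\<^esub> b [^]\<^bsub>G\<^esub> j = b [^]\<^bsub>G\<^esub> j \<otimes>\<^bsub>G\<^esub> g" if "g \<in> carrier G" for g and j :: nat
    using that b(1) inj_on_eq_iff[OF inj, of "g \<otimes>\<^bsub>G\<^esub> b [^]\<^bsub>G\<^esub> j" "b [^]\<^bsub>G\<^esub> j \<otimes>\<^bsub>G\<^esub> g"]
    by (simp add: f.hom_nat_pow)
  show ?thesis
    unfolding centralizer_stable_def
  proof (intro bexI exI conjI ballI impI)
    show "N \<ge> 2" by fact
    show "f b \<noteq> \<one>\<^bsub>H\<^esub>"
      using b(1,4) inj_on_eq_iff[OF inj, of b "\<one>\<^bsub>G\<^esub>"] by simp
    show "f s \<otimes>\<^bsub>H\<^esub> f b [^]\<^bsub>H\<^esub> N = f b \<otimes>\<^bsub>H\<^esub> f s"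
      using b(1,2) arg_cong[OF b(5), of f] by (simp add: f.hom_nat_pow)
    fix g assume g: "g \<in> carrier H" "g \<otimes>\<^bsub>H\<^esub> f b [^]\<^bsub>H\<^esub> (k * n) = f b [^]\<^bsub>H\<^esub> (k * n) \<otimes>\<^bsub>H\<^esub> g"
    then obtain g' where "g' \<in> carrier G" "g = f g'" using surj by blast
    then show "g \<otimes>\<^bsub>H\<^esub> f b [^]\<^bsub>H\<^esub> k = f b [^]\<^bsub>H\<^esub> k \<otimes>\<^bsub>H\<^esub> g"
      using g(2) comm cen by blast
  qed (use b(1,2) in auto)
qed

lemma (in group) centralizer_stable_subgroup:
  assumes "subgroup A G"
  shows "centralizer_stable k n (G\<lparr>carrier := A\<rparr>) \<longleftrightarrow>
    (\<exists>b\<in>A. \<exists>s\<in>A. \<exists>N::nat. N \<ge> 2 \<and> b \<noteq> \<one> \<and> s \<otimes> b [^] N = b \<otimes> s \<and>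
      (\<forall>g\<in>A. g \<otimes> b [^] (k * n) = b [^] (k * n) \<otimes> g \<longrightarrow> g \<otimes> b [^] k = b [^] k \<otimes> g))"
  by (simp add: centralizer_stable_def flip: nat_pow_consistent)

section \<open>The group \<open>G\<^sub>4\<close>\<close>

definition labels4 :: "nat \<Rightarrow> nat \<Rightarrow> (int \<times> int) list" where
  "labels4 k n = replicate k (int n, 1) @ [(1, int n)] @ replicate ((k - 1) div n) (int n, (int n)\<^sup>2)"

lemma nth_labels4:
  "e < length (labels4 k n) \<Longrightarrow>
    labels4 k n ! e = (if e < k then (int n, 1) else if e = k then (1, int n) else (int n, (int n)\<^sup>2))"
  by (auto simp: labels4_def nth_append nth_Cons split: nat.splits)

lemma G4_eq: "G4 k n = tv_group (labels4 k n)"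
  unfolding G4_def graph4_def labels4_def[symmetric] by (rule fundamental_group_two_vertex_graph)

text \<open>Eliminating the generator of \<open>U\<close> by means of the tree edge \<open>0\<close>, where it is the \<open>n\<close>-th power of
  the generator of \<open>V\<close>, turns the group into a multiple HNN extension of the integers. The
  labels are \<open>n ^ xp4 k d\<close>.\<close>

definition xp4 :: "nat \<Rightarrow> nat dart \<Rightarrow> nat" where
  "xp4 k d = (if snd d then (if fst d = k then 0 else 1)
    else (if fst d < k then 1 else if fst d = k then 2 else 3))"

locale graph4_group =
  fixes k n :: nat
  assumes n: "n > 1" and kn: "[k = 1] (mod n)" and k: "k > 1"
begin

abbreviation ls where "ls \<equiv> labels4 k n"
abbreviation G where "G \<equiv> tv_group ls"
abbreviation "v \<equiv> tv_gen ls (Vertex_Gen V)"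
abbreviation "u \<equiv> tv_gen ls (Vertex_Gen U)"
abbreviation "t e \<equiv> tv_gen ls (Edge_Gen e)"

sublocale hnn_labels "{0<..<length ls}" "\<lambda>d. int n ^ xp4 k d"
  by unfold_locales (use n in simp)

sublocale G: group G
  by (rule group_tv_group)

lemma length_ls: "k < length ls" "0 < length ls"
  using k by (auto simp: labels4_def)

lemma closed [simp]: "v \<in> carrier G" "u \<in> carrier G" "e < length ls \<Longrightarrow> t e \<in> carrier G"
  using tv_gen_closed[where ls = ls] by auto

lemma label_powers:
  assumes "e < length ls"
  shows "fst (ls ! e) = int n ^ xp4 k (e, True)" "int n * snd (ls ! e) = int n ^ xp4 k (e, False)"
  using assms by (auto simp: nth_labels4 xp4_def power2_eq_square power3_eq_cube)

lemma u_eq: "u = v [^]\<^bsub>G\<^esub> int n"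
  using tv_relation[where ls = ls and e = 0] tv_tree_gen[of ls] length_ls k by (auto simp: nth_labels4)

lemma t_relation:
  assumes "e < length ls"
  shows "t e \<otimes>\<^bsub>G\<^esub> v [^]\<^bsub>G\<^esub> (int n ^ xp4 k (e, False)) = v [^]\<^bsub>G\<^esub> (int n ^ xp4 k (e, True)) \<otimes>\<^bsub>G\<^esub> t e"
  using tv_relation[OF assms] unfolding u_eq
  by (simp add: G.int_pow_pow label_powers[OF assms])

text \<open>Sending \<open>u\<close> to \<open>base ^ n\<close> and the tree letter to
  \<open>1\<close> respects the relations of \<open>G\<close>. The map back sends
  \<open>base\<close> to \<open>v\<close>; the composite fixes the generators of \<open>G\<close>,
  whence injectivity.\<close>

lemma embedding:
  obtains \<psi> where "\<psi> \<in> hom G M" "inj_on \<psi> (carrier G)" "\<psi> v = base"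
proof -
  let ?t = "\<lambda>e. if e = 0 then \<one>\<^bsub>M\<^esub> else stable (e, True)"
  have "?t e \<otimes>\<^bsub>M\<^esub> (base [^]\<^bsub>M\<^esub> int n) [^]\<^bsub>M\<^esub> snd (ls ! e) = base [^]\<^bsub>M\<^esub> fst (ls ! e) \<otimes>\<^bsub>M\<^esub> ?t e"
    if e: "e < length ls" for e
  proof (cases "e = 0")
    case True
    moreover have "xp4 k (0, True) = 1" "xp4 k (0, False) = 1" using k by (auto simp: xp4_def)
    ultimately show ?thesis using label_powers[OF e] n by (auto simp: M.int_pow_pow)
  next
    case False
    then show ?thesis
      using hnn_relation[of "(e, True)"] label_powers[OF e] e by (simp add: M.int_pow_pow)
  qed
  then have "\<exists>\<psi>\<in>hom G M. \<psi> v = base \<and> \<psi> u = base [^]\<^bsub>M\<^esub> int n \<and> (\<forall>e<length ls. \<psi> (t e) = ?t e)"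
    by (intro tv_hom[OF group_M]) (use length_ls in auto)
  then obtain \<psi> where \<psi>: "\<psi> \<in> hom G M" "\<psi> v = base" "\<psi> u = base [^]\<^bsub>M\<^esub> int n"
    "\<forall>e<length ls. \<psi> (t e) = ?t e" by blast
  have "\<exists>\<theta>\<in>hom M G. \<theta> base = v \<and> (\<forall>e\<in>{0<..<length ls}. \<theta> (stable (e, True)) = t e)"
    by (intro hnn_hom[OF G.is_group]) (use t_relation in auto)
  then obtain \<theta> where \<theta>: "\<theta> \<in> hom M G" "\<theta> base = v"
    "\<forall>e\<in>{0<..<length ls}. \<theta> (stable (e, True)) = t e" by blast
  interpret \<theta>: group_hom M G \<theta>
    by unfold_locales (rule \<theta>(1))
  have "(\<theta> \<circ> \<psi>) x = id x" if "x \<in> carrier G" for x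
  proof (rule presented_group_hom_eqI[where \<phi> = "\<theta> \<circ> \<psi>" and \<psi> = id and S = "tv_gens ls"
        and R = "tv_relators ls" and H = G])
    show "\<theta> \<circ> \<psi> \<in> hom (presented_group (tv_gens ls) (tv_relators ls)) G"
      using \<psi>(1) \<theta>(1) hom_compose unfolding tv_group_def by blast
    show "(\<theta> \<circ> \<psi>) (gen_class (tv_gens ls) (tv_relators ls) g) = id (gen_class (tv_gens ls) (tv_relators ls) g)"
      if g: "g \<in> tv_gens ls" for g
    proof -
      consider p where "g = Vertex_Gen p" | e where "g = Edge_Gen e" "e < length ls"
        using g by (auto simp: tv_gens_def)
      then have "\<theta> (\<psi> (tv_gen ls g)) = tv_gen ls g"
      proof cases
        case 1
        then show ?thesis
          using \<psi>(2,3) \<theta>(2) u_eq by (cases p) (simp_all add: \<theta>.hom_int_pow)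
      next
        case 2
        then have "\<psi> (t e) = ?t e" using \<psi>(4) by blast
        moreover have "ls \<noteq> []" using length_ls by auto
        ultimately show ?thesis using 2 \<theta>(3) tv_tree_gen[of ls] by (cases "e = 0") auto
      qed
      then show ?thesis by (simp add: tv_gen_def)
    qed
  qed (use that G.is_group in \<open>auto simp: tv_group_def hom_def\<close>)
  then have "inj_on \<psi> (carrier G)" by (intro inj_on_inverseI[of _ \<theta>]) simp
  then show thesis using that \<psi> by blast
qed

text \<open>As \<open>n\<close> does not divide \<open>m\<close>, only a dart with label
  \<open>n ^ 0\<close> can be crossed, and that is the edge \<open>k\<close> leaving from its
  \<open>V\<close> end; its label \<open>1\<close> admits only the residue \<open>0\<close>. The
  empty path would require \<open>m = m n ^ 2\<close>.\<close>

lemma conveys_unit: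
  assumes "\<not> int n dvd m" "reduced w" "conveys m w (m * int n ^ 2)"
  obtains w' where "w = (0, (k, True)) # w'"
proof (cases w)
  case Nil
  then have "m = m * int n ^ 2" using assms(3) by simp
  then have "m = 0 \<or> int n ^ 2 = 1" by simp
  moreover have "int n ^ 2 > 1" using n by (intro one_less_power) auto
  ultimately show thesis using assms(1) by auto
next
  case (Cons a w')
  obtain r d where a: "a = (r, d)" by (cases a)
  have "int n ^ xp4 k d dvd m" using assms(3) Cons a by simp
  then have "xp4 k d = 0"
    using assms(1) by (metis dvd_power dvd_trans gr0I)
  moreover have "0 \<le> r" "r < int n ^ xp4 k d" using assms(2) Cons a by auto
  ultimately have "d = (k, True)" "r = 0"
    by (auto simp: xp4_def prod_eq_iff split: if_splits)
  then show thesis using that Cons a by simp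
qed

text \<open>Exponents occurring along a path that conjugates \<open>v ^ (m n\<^sup>2)\<close> to itself are \<open>m n ^ j\<close> with even
  \<open>j\<close>. The value \<open>j = 0\<close> would only be reached through the edge \<open>k\<close>, which the path then has to
  retrace. Hence \<open>j\<close> is at least \<open>2\<close>, and one factor \<open>n\<close> can be divided out throughout.\<close>

lemma conveys_divide:
  assumes m: "\<not> int n dvd m"
  shows "reduced w \<Longrightarrow> conveys (m * int n ^ (2 + 2 * i)) w (m * int n ^ 2)
    \<Longrightarrow> conveys (m * int n ^ (1 + 2 * i)) w (m * int n)"
proof (induction w arbitrary: i)
  case Nil
  have "m \<noteq> 0" using m by auto
  then have "int n ^ (2 + 2 * i) = int n ^ 2" using Nil by simp
  then have "2 + 2 * i = 2" using n power_inject_exp[of "int n"] by (metis of_nat_1 of_nat_less_iff)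
  then show ?case by simp
next
  case (Cons a w)
  obtain r d where a: "a = (r, d)" by (cases a)
  let ?p = "xp4 k d" and ?q = "xp4 k (bar d)"
  have w: "reduced w" and nc: "\<not> cancels d w" using Cons.prems(1) a by auto
  have n0: "int n ^ p \<noteq> 0" for p using n by simp
  have div: "int n ^ q * (m * int n ^ j div int n ^ p) = m * int n ^ (q + (j - p))"
    and dvd: "int n ^ p dvd m * int n ^ j" if "p \<le> j" for p q j
  proof -
    have e: "m * int n ^ j = int n ^ p * (m * int n ^ (j - p))"
      using that by (simp flip: power_add)
    show "int n ^ p dvd m * int n ^ j" unfolding e by simp
    show "int n ^ q * (m * int n ^ j div int n ^ p) = m * int n ^ (q + (j - p))"
      unfolding e using n0 by (simp add: power_add)
  qed
  have dv: "int n ^ ?p dvd m * int n ^ (2 + 2 * i)"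
    and cv: "conveys (int n ^ ?q * (m * int n ^ (2 + 2 * i) div int n ^ ?p)) w (m * int n ^ 2)"
    using Cons.prems(2) a by auto
  \<comment> \<open>The largest label is \<open>n ^ 3\<close>; if it divided \<open>m n ^ 2\<close>,
    then \<open>n\<close> would divide \<open>m\<close>.\<close>
  have le: "?p \<le> 2 + 2 * i"
  proof (rule ccontr)
    assume "\<not> ?p \<le> 2 + 2 * i"
    then have "?p = 3" "i = 0" by (auto simp: xp4_def split: if_splits)
    then have "int n ^ 2 * int n dvd int n ^ 2 * m" using dv by (simp add: power3_eq_cube power2_eq_square mult_ac)
    then show False using m n0[of 2] by (simp only: dvd_mult_cancel_left) simp
  qed
  have cv': "conveys (m * int n ^ (?q + (2 + 2 * i - ?p))) w (m * int n ^ 2)"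
    using cv unfolding div[OF le] .
  have "?p \<le> 1 + 2 * i"
  proof (rule ccontr)
    assume "\<not> ?p \<le> 1 + 2 * i"
    moreover have "?p \<le> 3" by (simp add: xp4_def)
    ultimately have "i = 0" "?p = 2 + 2 * i" using le by linarith+
    then have "?p = 2" by simp
    then have "d = (k, False)" by (auto simp: xp4_def prod_eq_iff split: if_splits)
    then have "conveys m w (m * int n ^ 2)" using cv' \<open>i = 0\<close> by (simp add: xp4_def)
    then obtain w' where "w = (0, (k, True)) # w'" using conveys_unit[OF m w] by blast
    then show False using nc \<open>d = (k, False)\<close> by (simp add: cancels_def)
  qed
  \<comment> \<open>The two labels of an edge agree in parity, so the new exponent of
    \<open>n\<close> is even. It could vanish only for \<open>?q = 0\<close> and
    \<open>?p = 2 + 2 * i\<close>, which has just been excluded.\<close>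
  moreover obtain i' where i': "?q + (2 + 2 * i - ?p) = 2 + 2 * i'"
  proof -
    have "even ?p = even ?q" by (auto simp: xp4_def)
    then have "even (?q + (2 + 2 * i - ?p))" using le by auto
    then obtain c where c: "?q + (2 + 2 * i - ?p) = 2 * c" by (rule evenE)
    have "?q + (2 + 2 * i - ?p) \<ge> 2"
      using le \<open>?p \<le> 1 + 2 * i\<close> \<open>even ?p = even ?q\<close>
      by (auto simp: xp4_def split: if_splits)
    then have "c \<ge> 1" using c by linarith
    then show thesis using that[of "c - 1"] c by linarith
  qed
  moreover have "?q + (1 + 2 * i - ?p) = 1 + 2 * i'"
    using i' \<open>?p \<le> 1 + 2 * i\<close> by linarith
  ultimately show ?case
    using Cons.IH[OF w, of i'] cv' a div[of ?p "1 + 2 * i" ?q] dvd[of ?p "1 + 2 * i"] by simp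
qed

lemma commutes_divide:
  assumes "\<not> int n dvd m" "g \<in> carrier G"
    and "v [^]\<^bsub>G\<^esub> (m * int n ^ 2) \<otimes>\<^bsub>G\<^esub> g = g \<otimes>\<^bsub>G\<^esub> v [^]\<^bsub>G\<^esub> (m * int n ^ 2)"
  shows "v [^]\<^bsub>G\<^esub> (m * int n) \<otimes>\<^bsub>G\<^esub> g = g \<otimes>\<^bsub>G\<^esub> v [^]\<^bsub>G\<^esub> (m * int n)"
proof -
  obtain \<psi> where \<psi>: "\<psi> \<in> hom G M" "inj_on \<psi> (carrier G)" "\<psi> v = base" using embedding .
  interpret \<psi>: group_hom G M \<psi>
    by unfold_locales (rule \<psi>(1))
  have comm: "v [^]\<^bsub>G\<^esub> z \<otimes>\<^bsub>G\<^esub> g = g \<otimes>\<^bsub>G\<^esub> v [^]\<^bsub>G\<^esub> z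
      \<longleftrightarrow> base [^]\<^bsub>M\<^esub> z \<otimes>\<^bsub>M\<^esub> \<psi> g = \<psi> g \<otimes>\<^bsub>M\<^esub> base [^]\<^bsub>M\<^esub> z" for z :: int
    using inj_on_eq_iff[OF \<psi>(2), of "v [^]\<^bsub>G\<^esub> z \<otimes>\<^bsub>G\<^esub> g" "g \<otimes>\<^bsub>G\<^esub> v [^]\<^bsub>G\<^esub> z"] assms(2) \<psi>(3)
    by (simp add: \<psi>.hom_int_pow)
  obtain w i where w: "reduced w" "\<psi> g = val (w, i)" using val_surj[of "\<psi> g"] assms(2) by auto
  show ?thesis
    using assms(3) conveys_divide[OF assms(1) w(1), of 0]
    unfolding comm w(2) commutes_base_pow_iff[OF w(1)] by simp
qed

lemma v_pow_eq_one: "v [^]\<^bsub>G\<^esub> (z :: int) = \<one>\<^bsub>G\<^esub> \<Longrightarrow> z = 0"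
proof -
  assume z: "v [^]\<^bsub>G\<^esub> z = \<one>\<^bsub>G\<^esub>"
  obtain \<psi> where \<psi>: "\<psi> \<in> hom G M" "inj_on \<psi> (carrier G)" "\<psi> v = base" using embedding .
  interpret \<psi>: group_hom G M \<psi>
    by unfold_locales (rule \<psi>(1))
  have "val ([], z) = val ([], 0)" using arg_cong[OF z, of \<psi>] \<psi>(3) by (simp add: \<psi>.hom_int_pow)
  then show "z = 0" using val_inj[of "([], z)" "([], 0)"] by simp
qed

text \<open>Edge \<open>k\<close> has label \<open>1\<close> at \<open>V\<close> and, after
  \<open>u\<close> is replaced by \<open>v ^ n\<close>, label \<open>n ^ 2\<close> at the other end.
  Hence no divisibility is required of \<open>z\<close>, and powers of \<open>t k\<close> can serve
  as the element \<open>s\<close> of \<open>centralizer_stable\<close>.\<close>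

lemma t_scaling:
  fixes i :: nat
  shows "t k [^]\<^bsub>G\<^esub> i \<otimes>\<^bsub>G\<^esub> v [^]\<^bsub>G\<^esub> (z * (int n ^ 2) ^ i) = v [^]\<^bsub>G\<^esub> z \<otimes>\<^bsub>G\<^esub> t k [^]\<^bsub>G\<^esub> i"
proof (induction i)
  case (Suc i)
  have c: "t k \<in> carrier G" using length_ls by simp
  have "t k \<otimes>\<^bsub>G\<^esub> v [^]\<^bsub>G\<^esub> (int n ^ 2) = v \<otimes>\<^bsub>G\<^esub> t k"
    using t_relation[of k] length_ls k by (simp add: xp4_def)
  from G.intertwine_int_pow[OF _ _ _ this] c
  have eq: "t k \<otimes>\<^bsub>G\<^esub> v [^]\<^bsub>G\<^esub> (int n ^ 2 * q) = v [^]\<^bsub>G\<^esub> q \<otimes>\<^bsub>G\<^esub> t k" for q :: int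
    by (simp add: G.int_pow_pow)
  have "t k [^]\<^bsub>G\<^esub> Suc i \<otimes>\<^bsub>G\<^esub> v [^]\<^bsub>G\<^esub> (z * (int n ^ 2) ^ Suc i)
      = t k [^]\<^bsub>G\<^esub> i \<otimes>\<^bsub>G\<^esub> (t k \<otimes>\<^bsub>G\<^esub> v [^]\<^bsub>G\<^esub> (int n ^ 2 * (z * (int n ^ 2) ^ i)))"
    using c by (simp add: G.m_assoc mult_ac)
  also have "\<dots> = v [^]\<^bsub>G\<^esub> z \<otimes>\<^bsub>G\<^esub> t k [^]\<^bsub>G\<^esub> i \<otimes>\<^bsub>G\<^esub> t k"
    unfolding eq using c Suc.IH by (simp flip: G.m_assoc)
  finally show ?case using c by (simp add: G.m_assoc)
qed simp

text \<open>Take the least \<open>m > 0\<close> for which all conjugates of \<open>v ^ m\<close> lie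
  in \<open>B\<close>. If \<open>m = n m'\<close>, then \<open>v ^ m'\<close> is conjugate by
  \<open>t k\<close> to \<open>v ^ (m' n ^ 2)\<close>, the \<open>n\<close>-th power of
  \<open>v ^ m\<close>, so \<open>m'\<close> would qualify too.\<close>

lemma ex_normal_power:
  assumes "finite_index_subgroup B G"
  obtains m :: nat where "\<not> n dvd m" "v [^]\<^bsub>G\<^esub> m \<in> B"
proof -
  have B: "subgroup B G" using assms by (simp add: finite_index_subgroup_def)
  obtain D :: nat where D: "D > 0" "\<forall>g\<in>carrier G. g [^]\<^bsub>G\<^esub> D \<in> B"
    by (rule G.pow_in_finite_index_subgroup[OF assms])
  \<comment> \<open>All conjugates are demanded because \<open>t k\<close>, by which the descent
    conjugates, may lie outside \<open>B\<close>.\<close>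
  define Q where "Q m \<longleftrightarrow> m > 0 \<and> (\<forall>g\<in>carrier G. g \<otimes>\<^bsub>G\<^esub> v [^]\<^bsub>G\<^esub> m \<otimes>\<^bsub>G\<^esub> inv\<^bsub>G\<^esub> g \<in> B)" for m :: nat
  have "Q D" unfolding Q_def
  proof (intro conjI ballI)
    fix g assume g: "g \<in> carrier G"
    then show "g \<otimes>\<^bsub>G\<^esub> v [^]\<^bsub>G\<^esub> D \<otimes>\<^bsub>G\<^esub> inv\<^bsub>G\<^esub> g \<in> B"
      using bspec[OF D(2), of "g \<otimes>\<^bsub>G\<^esub> v \<otimes>\<^bsub>G\<^esub> inv\<^bsub>G\<^esub> g"] by (simp add: G.conj_nat_pow)
  qed (rule D(1))
  define m where "m = (LEAST m. Q m)"
  have Qm: "Q m" unfolding m_def by (rule LeastI) (rule \<open>Q D\<close>)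
  have "\<not> n dvd m"
  proof
    assume "n dvd m"
    then obtain m' where m': "m = n * m'" by blast
    have "Q m'" unfolding Q_def
    proof (intro conjI ballI)
      show "m' > 0" using Qm m' by (simp add: Q_def)
      fix g assume g: "g \<in> carrier G"
      have c: "t k \<in> carrier G" using length_ls by simp
      have "v [^]\<^bsub>G\<^esub> int m' \<otimes>\<^bsub>G\<^esub> t k = t k \<otimes>\<^bsub>G\<^esub> v [^]\<^bsub>G\<^esub> (int m' * int n ^ 2)"
        using t_scaling[of 1 "int m'"] c by simp
      also have "int m' * int n ^ 2 = int (m * n)" by (simp add: m' power2_eq_square)
      finally have "v [^]\<^bsub>G\<^esub> m' = t k \<otimes>\<^bsub>G\<^esub> v [^]\<^bsub>G\<^esub> (m * n) \<otimes>\<^bsub>G\<^esub> inv\<^bsub>G\<^esub> t k"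
        using c by (simp only: int_pow_int) (simp add: G.inv_solve_right)
      then have "g \<otimes>\<^bsub>G\<^esub> v [^]\<^bsub>G\<^esub> m' \<otimes>\<^bsub>G\<^esub> inv\<^bsub>G\<^esub> g
          = (g \<otimes>\<^bsub>G\<^esub> t k) \<otimes>\<^bsub>G\<^esub> (v [^]\<^bsub>G\<^esub> m) [^]\<^bsub>G\<^esub> n \<otimes>\<^bsub>G\<^esub> inv\<^bsub>G\<^esub> (g \<otimes>\<^bsub>G\<^esub> t k)"
        using g c by (simp add: G.m_assoc G.inv_mult_group G.nat_pow_pow)
      also have "\<dots> = ((g \<otimes>\<^bsub>G\<^esub> t k) \<otimes>\<^bsub>G\<^esub> v [^]\<^bsub>G\<^esub> m \<otimes>\<^bsub>G\<^esub> inv\<^bsub>G\<^esub> (g \<otimes>\<^bsub>G\<^esub> t k)) [^]\<^bsub>G\<^esub> n"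
        using g c by (simp only: G.conj_nat_pow G.m_closed G.nat_pow_closed closed)
      also have "\<dots> \<in> B"
        using Qm g c by (intro G.subgroup_nat_pow_closed[OF B]) (simp add: Q_def)
      finally show "g \<otimes>\<^bsub>G\<^esub> v [^]\<^bsub>G\<^esub> m' \<otimes>\<^bsub>G\<^esub> inv\<^bsub>G\<^esub> g \<in> B" .
    qed
    then have "m \<le> m'" unfolding m_def by (rule Least_le)
    moreover have "m' > 0" using Qm m' by (simp add: Q_def)
    ultimately show False using m' n by simp
  qed
  moreover have "v [^]\<^bsub>G\<^esub> m \<in> B" using Qm by (auto simp: Q_def dest: bspec[of _ _ "\<one>\<^bsub>G\<^esub>"])
  ultimately show thesis using that by blast
qed

lemma centralizer_stable_finite_index:
  assumes "finite_index_subgroup B G"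
  shows "centralizer_stable k n (G\<lparr>carrier := B\<rparr>)"
proof -
  have B: "subgroup B G" using assms by (simp add: finite_index_subgroup_def)
  obtain D :: nat where D: "D > 0" "\<forall>g\<in>carrier G. g [^]\<^bsub>G\<^esub> D \<in> B"
    by (rule G.pow_in_finite_index_subgroup[OF assms])
  obtain m :: nat where m: "\<not> n dvd m" "v [^]\<^bsub>G\<^esub> m \<in> B" using ex_normal_power[OF assms] .
  \<comment> \<open>This is \<open>u ^ m\<close>. Thus \<open>b ^ (k n)\<close> and
    \<open>b ^ k\<close> are the powers of \<open>v\<close> with exponents \<open>m k n ^ 2\<close>
    and \<open>m k n\<close>, as \<open>commutes_divide\<close> requires.\<close>
  define b where "b = v [^]\<^bsub>G\<^esub> (m * n)"
  \<comment> \<open>The power \<open>D\<close> puts \<open>s\<close> into \<open>B\<close>; the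
    scaling factor \<open>n ^ 2\<close> of \<open>t k\<close> then becomes
    \<open>N = (n ^ 2) ^ D\<close>.\<close>
  define s where "s = t k [^]\<^bsub>G\<^esub> D"
  have b_pow: "b [^]\<^bsub>G\<^esub> j = v [^]\<^bsub>G\<^esub> (int m * int n * int j)" for j :: nat
    by (simp add: b_def G.nat_pow_pow int_pow_int flip: of_nat_mult)
  have b: "b \<in> B"
    using G.subgroup_nat_pow_closed[OF B m(2), of n] by (simp add: b_def G.nat_pow_pow)
  have s: "s \<in> B" unfolding s_def using length_ls by (intro bspec[OF D(2)]) simp
  have N: "(n\<^sup>2) ^ D \<ge> 2"
  proof -
    have "2 ^ 1 \<le> n ^ (2 * D)" using n D(1) by (intro order_trans[OF power_increasing power_mono]) auto
    then show ?thesis by (simp add: power_mult)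
  qed
  have b1: "b \<noteq> \<one>\<^bsub>G\<^esub>"
  proof
    assume "b = \<one>\<^bsub>G\<^esub>"
    then have "int m * int n = 0" using b_pow[of 1] v_pow_eq_one[of "int m * int n"]
      by (simp add: b_def)
    then show False using m(1) n by auto
  qed
  have sb: "s \<otimes>\<^bsub>G\<^esub> b [^]\<^bsub>G\<^esub> ((n\<^sup>2) ^ D) = b \<otimes>\<^bsub>G\<^esub> s"
  proof -
    have "b = v [^]\<^bsub>G\<^esub> (int m * int n)" by (simp add: b_def flip: int_pow_int)
    then show ?thesis
      using t_scaling[of D "int m * int n"] unfolding b_pow s_def by simp
  qed
  have cen: "g \<otimes>\<^bsub>G\<^esub> b [^]\<^bsub>G\<^esub> k = b [^]\<^bsub>G\<^esub> k \<otimes>\<^bsub>G\<^esub> g"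
    if "g \<in> B" "g \<otimes>\<^bsub>G\<^esub> b [^]\<^bsub>G\<^esub> (k * n) = b [^]\<^bsub>G\<^esub> (k * n) \<otimes>\<^bsub>G\<^esub> g" for g
  proof -
    \<comment> \<open>Here the congruence enters: multiplying \<open>m\<close> by \<open>k\<close>
      must not make it divisible by \<open>n\<close>.\<close>
    have "coprime n k" using cong_imp_coprime[OF cong_sym[OF kn]] by (simp add: coprime_commute)
    then have nd: "\<not> int n dvd int (m * k)"
      using m(1) by (simp only: of_nat_dvd_iff coprime_dvd_mult_left_iff) simp
    have g: "g \<in> carrier G" using that(1) subgroup.subset[OF B] by blast
    have e1: "int m * int n * int (k * n) = int (m * k) * int n ^ 2"
      and e2: "int m * int n * int k = int (m * k) * int n"
      by (simp_all add: power2_eq_square)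
    have "v [^]\<^bsub>G\<^esub> (int (m * k) * int n ^ 2) \<otimes>\<^bsub>G\<^esub> g = g \<otimes>\<^bsub>G\<^esub> v [^]\<^bsub>G\<^esub> (int (m * k) * int n ^ 2)"
      by (rule HOL.sym) (rule that(2)[unfolded b_pow e1])
    from commutes_divide[OF nd g this] show ?thesis
      unfolding b_pow e2 by (rule HOL.sym)
  qed
  show ?thesis
    unfolding G.centralizer_stable_subgroup[OF B]
    by (intro bexI[OF _ b] bexI[OF _ s] exI[of _ "(n\<^sup>2) ^ D"] conjI ballI impI N b1 sb) (rule cen)
qed

end

section \<open>The group \<open>G\<^sub>1\<close>\<close>

definition labels1 :: "nat \<Rightarrow> nat \<Rightarrow> (int \<times> int) list" where
  "labels1 k n = [(int k, int k * int n), (int k * int n, int k)]"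

lemma G1_eq: "G1 k n = tv_group (labels1 k n)"
  unfolding G1_def graph1_def labels1_def[symmetric] by (rule fundamental_group_two_vertex_graph)

text \<open>The HNN extension is the Baumslag--Solitar group \<open>BS(k, kn)\<close>, in which \<open>G\<close> embeds with index two:
  the generator of \<open>V\<close> goes to \<open>a\<close>, that of \<open>U\<close> to the conjugate of \<open>a\<close> by the inverse of the stable
  letter \<open>T\<close>, and the edge \<open>1\<close> to the square of \<open>T\<close>.\<close>

locale graph1_group =
  fixes k n :: nat
  assumes n: "n > 1" and k: "k > 1"
begin

abbreviation ls where "ls \<equiv> labels1 k n"
abbreviation G where "G \<equiv> tv_group ls"
abbreviation "v \<equiv> tv_gen ls (Vertex_Gen V)"
abbreviation "u \<equiv> tv_gen ls (Vertex_Gen U)"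
abbreviation "t \<equiv> tv_gen ls (Edge_Gen (Suc 0))"

sublocale hnn_labels "UNIV :: unit set" "\<lambda>d. if snd d then int k * int n else int k"
  by unfold_locales (use k n in simp)

sublocale G: group G
  by (rule group_tv_group)

abbreviation a where "a \<equiv> base"
abbreviation T where "T \<equiv> stable ((), True)"

lemma stable_False: "stable ((), False) = inv\<^bsub>M\<^esub> T"
  by (simp add: stable_def)

lemma ls_simps: "length ls = 2" "ls \<noteq> []" "ls ! 0 = (int k, int k * int n)"
  "ls ! Suc 0 = (int k * int n, int k)"
  by (simp_all add: labels1_def)

lemma closed [simp]: "v \<in> carrier G" "u \<in> carrier G" "t \<in> carrier G"
  using tv_gen_closed[where ls = ls] by (auto simp: ls_simps)

lemma BS_relation: "T \<otimes>\<^bsub>M\<^esub> a [^]\<^bsub>M\<^esub> int k = a [^]\<^bsub>M\<^esub> (int k * int n) \<otimes>\<^bsub>M\<^esub> T"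
  using hnn_relation[of "((), True)"] by simp

lemma G_relations:
  "u [^]\<^bsub>G\<^esub> (int k * int n) = v [^]\<^bsub>G\<^esub> int k"
  "t \<otimes>\<^bsub>G\<^esub> u [^]\<^bsub>G\<^esub> int k = v [^]\<^bsub>G\<^esub> (int k * int n) \<otimes>\<^bsub>G\<^esub> t"
  using tv_relation[where ls = ls and e = 0] tv_relation[where ls = ls and e = "Suc 0"] tv_tree_gen[of ls]
  by (simp_all add: ls_simps)

text \<open>The graph of \<open>G\<close> is a double cover of the loop of
  \<open>BS(k, k n)\<close>, so a dart has one lift at each vertex (\<open>True\<close> is
  \<open>V\<close>). Matching labels shows that the lift runs along edge \<open>1\<close> if
  \<open>p = snd d\<close> and along the tree edge, with value \<open>1\<close>, otherwise.\<close>

definition cross :: "bool \<Rightarrow> unit dart \<Rightarrow> (vertex, nat) generator word set" where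
  "cross p d = (if p = snd d then (if p then t else inv\<^bsub>G\<^esub> t) else \<one>\<^bsub>G\<^esub>)"

sublocale P: typed_rep UNIV "\<lambda>d :: unit dart. if snd d then int k * int n else int k" G
  "\<lambda>p. if p then v else u" cross
proof unfold_locales
  fix p :: bool and d :: "unit dart"
  show "cross p d \<otimes>\<^bsub>G\<^esub> cross (\<not> p) (bar d) = \<one>\<^bsub>G\<^esub>" by (simp add: cross_def)
  have "inv\<^bsub>G\<^esub> t \<otimes>\<^bsub>G\<^esub> v [^]\<^bsub>G\<^esub> (int k * int n) = u [^]\<^bsub>G\<^esub> int k \<otimes>\<^bsub>G\<^esub> inv\<^bsub>G\<^esub> t"
    using G.intertwine_inv[OF _ _ _ G_relations(2)] by simp
  then show "cross p d \<otimes>\<^bsub>G\<^esub> (if \<not> p then v else u) [^]\<^bsub>G\<^esub> (if snd (bar d) then int k * int n else int k)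
      = (if p then v else u) [^]\<^bsub>G\<^esub> (if snd d then int k * int n else int k) \<otimes>\<^bsub>G\<^esub> cross p d"
    using G_relations by (simp add: cross_def)
qed (auto simp: cross_def)

section \<open>The embedding into the Baumslag--Solitar group\<close>

lemma embedding_exists:
  "\<exists>\<pi>\<in>hom G M. \<pi> v = a \<and> \<pi> u = inv\<^bsub>M\<^esub> T \<otimes>\<^bsub>M\<^esub> a \<otimes>\<^bsub>M\<^esub> T \<and> \<pi> t = T \<otimes>\<^bsub>M\<^esub> T"
proof -
  let ?u = "inv\<^bsub>M\<^esub> T \<otimes>\<^bsub>M\<^esub> a \<otimes>\<^bsub>M\<^esub> T" and ?t = "\<lambda>e. if e = 0 then \<one>\<^bsub>M\<^esub> else T \<otimes>\<^bsub>M\<^esub> T"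
  have T: "T \<in> carrier M" by simp
  have u_pow: "?u [^]\<^bsub>M\<^esub> z = inv\<^bsub>M\<^esub> T \<otimes>\<^bsub>M\<^esub> a [^]\<^bsub>M\<^esub> z \<otimes>\<^bsub>M\<^esub> T" for z :: int
    using M.conj_int_pow[of "inv\<^bsub>M\<^esub> T" a z] T by simp
  have TT: "T \<otimes>\<^bsub>M\<^esub> (inv\<^bsub>M\<^esub> T \<otimes>\<^bsub>M\<^esub> x) = x" "inv\<^bsub>M\<^esub> T \<otimes>\<^bsub>M\<^esub> (T \<otimes>\<^bsub>M\<^esub> x) = x" if "x \<in> carrier M" for x
    using T that by (simp_all flip: M.m_assoc)
  have r0: "?u [^]\<^bsub>M\<^esub> (int k * int n) = a [^]\<^bsub>M\<^esub> int k"
    unfolding u_pow using BS_relation[symmetric] T by (simp add: M.m_assoc TT)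
  have r1: "T \<otimes>\<^bsub>M\<^esub> T \<otimes>\<^bsub>M\<^esub> ?u [^]\<^bsub>M\<^esub> int k = a [^]\<^bsub>M\<^esub> (int k * int n) \<otimes>\<^bsub>M\<^esub> (T \<otimes>\<^bsub>M\<^esub> T)"
  proof -
    have "T \<otimes>\<^bsub>M\<^esub> T \<otimes>\<^bsub>M\<^esub> ?u [^]\<^bsub>M\<^esub> int k = T \<otimes>\<^bsub>M\<^esub> a [^]\<^bsub>M\<^esub> int k \<otimes>\<^bsub>M\<^esub> T"
      unfolding u_pow using T by (simp add: M.m_assoc TT)
    then show ?thesis using T by (simp add: BS_relation M.m_assoc)
  qed
  have "\<exists>\<pi>\<in>hom G M. \<pi> v = a \<and> \<pi> u = ?u \<and> (\<forall>e<length ls. \<pi> (tv_gen ls (Edge_Gen e)) = ?t e)"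
  proof (rule tv_hom[OF group_M])
    fix e assume "e < length ls"
    then have "e = 0 \<or> e = Suc 0" by (auto simp: ls_simps)
    then show "?t e \<otimes>\<^bsub>M\<^esub> ?u [^]\<^bsub>M\<^esub> snd (ls ! e) = a [^]\<^bsub>M\<^esub> fst (ls ! e) \<otimes>\<^bsub>M\<^esub> ?t e"
      using r0 r1 T by (auto simp: ls_simps)
  qed (use T in \<open>auto simp: ls_simps\<close>)
  then obtain \<pi> where \<pi>: "\<pi> \<in> hom G M" "\<pi> v = a" "\<pi> u = ?u"
    "\<forall>e<length ls. \<pi> (tv_gen ls (Edge_Gen e)) = ?t e" by blast
  have "Suc 0 < length ls" by (simp add: ls_simps)
  then have "\<pi> t = T \<otimes>\<^bsub>M\<^esub> T" using \<pi>(4) by simp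
  then show ?thesis using \<pi> by blast
qed

definition emb :: "(vertex, nat) generator word set \<Rightarrow> unit option word set" where
  "emb = (SOME \<pi>. \<pi> \<in> hom G M \<and> \<pi> v = a \<and> \<pi> u = inv\<^bsub>M\<^esub> T \<otimes>\<^bsub>M\<^esub> a \<otimes>\<^bsub>M\<^esub> T \<and> \<pi> t = T \<otimes>\<^bsub>M\<^esub> T)"

lemma emb: "emb \<in> hom G M" "emb v = a" "emb u = inv\<^bsub>M\<^esub> T \<otimes>\<^bsub>M\<^esub> a \<otimes>\<^bsub>M\<^esub> T" "emb t = T \<otimes>\<^bsub>M\<^esub> T"
  using someI_ex[OF embedding_exists[unfolded Bex_def], folded emb_def] by blast+

sublocale emb: group_hom G M emb
  by unfold_locales (rule emb(1))

text \<open>Prefixing the tree edge, which is trivial in \<open>G\<close>, moves the start of a path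
  to the other vertex without changing its value. In this way \<open>u\<close> and the inverse of
  \<open>t\<close>, which attach at \<open>U\<close> or lead there, also act on paths starting at
  \<open>V\<close>.\<close>

lemma path_surj:
  assumes "g \<in> carrier G"
  shows "\<exists>x. reduced (fst x) \<and> g = P.val True x"
proof -
  have stepU: "\<exists>y. reduced (fst y) \<and> cross p d \<otimes>\<^bsub>G\<^esub> P.val (\<not> p) x = P.val p y"
    if "reduced (fst x)" for p d x
    using that P.cross_val[of d "fst x" p "snd x"] reduced_step[of d "fst x" "snd x"]
    by (intro exI[of _ "step d x"]) simp
  have actU: "\<exists>y. reduced (fst y) \<and> (if p then v else u) [^]\<^bsub>G\<^esub> (z :: int) \<otimes>\<^bsub>G\<^esub> P.val p x = P.val p y"
    if "reduced (fst x)" for p z x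
    using that P.vgen_val[of "fst x" p z "snd x"] reduced_act[of "fst x" z "snd x"]
    by (intro exI[of _ "act z x"]) simp
  have val_c: "P.val p x \<in> carrier G" if "reduced (fst x)" for p x
    using that P.val_closed[of "fst x" p "snd x"] by simp
  have toU: "\<exists>y. reduced (fst y) \<and> P.val p x = P.val (\<not> p) y" if "reduced (fst x)" for p x
    using stepU[OF that, of "\<not> p" "((), p)"] val_c[OF that] by (simp add: cross_def)
  have vU: "\<exists>y. reduced (fst y) \<and> v [^]\<^bsub>G\<^esub> (z :: int) \<otimes>\<^bsub>G\<^esub> P.val True x = P.val True y"
    if "reduced (fst x)" for z x
    using actU[OF that, of True z] by simp
  have uU: "\<exists>y. reduced (fst y) \<and> u [^]\<^bsub>G\<^esub> (z :: int) \<otimes>\<^bsub>G\<^esub> P.val True x = P.val True y"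
    if x: "reduced (fst x)" for z x
  proof -
    obtain y where y: "reduced (fst y)" "P.val True x = P.val False y" using toU[OF x, of True] by auto
    obtain y' where y': "reduced (fst y')" "u [^]\<^bsub>G\<^esub> z \<otimes>\<^bsub>G\<^esub> P.val False y = P.val False y'"
      using actU[OF y(1), of False z] by auto
    show ?thesis using toU[OF y'(1), of False] y'(2) by (simp add: y(2))
  qed
  have tU: "\<exists>y. reduced (fst y) \<and> t \<otimes>\<^bsub>G\<^esub> P.val True x = P.val True y" if x: "reduced (fst x)" for x
  proof -
    obtain y where y: "reduced (fst y)" "P.val True x = P.val False y" using toU[OF x, of True] by auto
    show ?thesis using stepU[OF y(1), of True "((), True)"] by (simp add: cross_def y(2))
  qed
  have tU': "\<exists>y. reduced (fst y) \<and> inv\<^bsub>G\<^esub> t \<otimes>\<^bsub>G\<^esub> P.val True x = P.val True y" if x: "reduced (fst x)" for x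
  proof -
    obtain y where y: "reduced (fst y)" "inv\<^bsub>G\<^esub> t \<otimes>\<^bsub>G\<^esub> P.val True x = P.val False y"
      using stepU[OF x, of False "((), False)"] by (auto simp: cross_def)
    show ?thesis using toU[OF y(1), of False] by (simp add: y(2))
  qed
  have inv_pow: "inv\<^bsub>G\<^esub> x = x [^]\<^bsub>G\<^esub> (-1 :: int)" if "x \<in> carrier G" for x
    using that by (simp add: G.int_pow_neg)
  have edges: "g = Vertex_Gen V \<or> g = Vertex_Gen U \<or> g = Edge_Gen 0 \<or> g = Edge_Gen (Suc 0)" if "g \<in> tv_gens ls" for g
    using that by (auto simp: tv_gens_def ls_simps less_2_cases_iff) (metis vertex.exhaust)
  have t0: "tv_gen ls (Edge_Gen 0) = \<one>\<^bsub>G\<^esub>" using tv_tree_gen[of ls] by (simp add: ls_simps)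
  have closure: "\<exists>y. reduced (fst y) \<and> tv_gen ls g \<otimes>\<^bsub>G\<^esub> x = P.val True y"
    "\<exists>y. reduced (fst y) \<and> inv\<^bsub>G\<^esub> tv_gen ls g \<otimes>\<^bsub>G\<^esub> x = P.val True y"
    if g: "g \<in> tv_gens ls" and x: "\<exists>y. reduced (fst y) \<and> x = P.val True y" for g x
  proof -
    obtain y where y: "reduced (fst y)" "x = P.val True y" using x by blast
    note c = val_c[OF y(1), of True]
    have triv: "\<exists>y'. reduced (fst y') \<and> P.val True y = P.val True y'" using y(1) by blast
    show "\<exists>y. reduced (fst y) \<and> tv_gen ls g \<otimes>\<^bsub>G\<^esub> x = P.val True y"
      using edges[OF g] vU[OF y(1), of 1] uU[OF y(1), of 1] tU[OF y(1)] triv y(2) c t0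
      by (elim disjE) simp_all
    show "\<exists>y. reduced (fst y) \<and> inv\<^bsub>G\<^esub> tv_gen ls g \<otimes>\<^bsub>G\<^esub> x = P.val True y"
      using edges[OF g] vU[OF y(1), of "-1"] uU[OF y(1), of "-1"] tU'[OF y(1)] triv y(2) c t0
      by (elim disjE) (simp_all add: inv_pow[of v] inv_pow[of u])
  qed
  show ?thesis
    using assms unfolding tv_group_def
  proof (induction rule: presented_group_induct)
    case one
    show ?case unfolding tv_group_def[symmetric]
      by (intro exI[of _ "([], 0)"]) simp
  next
    case (gen g x)
    then show ?case using closure(1)[of g x] by (simp add: tv_group_def tv_gen_def)
  next
    case (inv g x)
    then show ?case using closure(2)[of g x] by (simp add: tv_group_def tv_gen_def)
  qed
qed

definition base_change :: "bool \<Rightarrow> unit option word set" where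
  "base_change p = (if p then \<one>\<^bsub>M\<^esub> else T)"

lemma base_change_closed [simp]: "base_change p \<in> carrier M"
  by (simp add: base_change_def)

text \<open>A path in the graph of \<open>G\<close> is sent to the same path in the graph of \<open>BS(k, kn)\<close>, up to the
  change of base point.\<close>

lemma emb_path:
  "reduced w \<Longrightarrow> \<exists>q. emb (P.val p (w, i)) = inv\<^bsub>M\<^esub> base_change p \<otimes>\<^bsub>M\<^esub> val (w, i) \<otimes>\<^bsub>M\<^esub> base_change q"
proof (induction w arbitrary: p)
  case Nil
  have "emb ((if p then v else u) [^]\<^bsub>G\<^esub> i) = inv\<^bsub>M\<^esub> base_change p \<otimes>\<^bsub>M\<^esub> a [^]\<^bsub>M\<^esub> i \<otimes>\<^bsub>M\<^esub> base_change p"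
    using M.conj_int_pow[of "inv\<^bsub>M\<^esub> T" a i] by (simp add: emb.hom_int_pow emb base_change_def)
  then show ?case by auto
next
  case (Cons b w)
  obtain r d where b: "b = (r, d)" by (cases b)
  have w: "reduced w" using Cons.prems b by simp
  obtain q where q: "emb (P.val (\<not> p) (w, i)) = inv\<^bsub>M\<^esub> base_change (\<not> p) \<otimes>\<^bsub>M\<^esub> val (w, i) \<otimes>\<^bsub>M\<^esub> base_change q"
    using Cons.IH[OF w] by blast
  have T: "T \<in> carrier M" by simp
  have TT: "T \<otimes>\<^bsub>M\<^esub> (inv\<^bsub>M\<^esub> T \<otimes>\<^bsub>M\<^esub> x) = x" "inv\<^bsub>M\<^esub> T \<otimes>\<^bsub>M\<^esub> (T \<otimes>\<^bsub>M\<^esub> x) = x" if "x \<in> carrier M" for x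
    using T that by (simp_all flip: M.m_assoc)
  have vg: "emb ((if p then v else u) [^]\<^bsub>G\<^esub> r) = inv\<^bsub>M\<^esub> base_change p \<otimes>\<^bsub>M\<^esub> a [^]\<^bsub>M\<^esub> r \<otimes>\<^bsub>M\<^esub> base_change p"
    using M.conj_int_pow[of "inv\<^bsub>M\<^esub> T" a r] by (simp add: emb.hom_int_pow emb base_change_def)
  have cr: "emb (cross p d) = inv\<^bsub>M\<^esub> base_change p \<otimes>\<^bsub>M\<^esub> stable d \<otimes>\<^bsub>M\<^esub> base_change (\<not> p)"
    using T by (cases d) (auto simp: cross_def base_change_def emb stable_False M.m_assoc M.inv_mult_group)
  have tt: "base_change p' \<otimes>\<^bsub>M\<^esub> (inv\<^bsub>M\<^esub> base_change p' \<otimes>\<^bsub>M\<^esub> x) = x" if "x \<in> carrier M" for x p'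
    using that by (simp flip: M.m_assoc)
  have "emb (P.val p (b # w, i)) = inv\<^bsub>M\<^esub> base_change p \<otimes>\<^bsub>M\<^esub> val (b # w, i) \<otimes>\<^bsub>M\<^esub> base_change q"
    using b w by (simp add: vg cr q M.m_assoc tt del: if_split)
  then show ?case by blast
qed

text \<open>A path representing a kernel element may end at either vertex, so its normal form is
  empty or the single dart of the inverse of \<open>T\<close>. The latter lifts at \<open>V\<close>
  to the tree edge, whose value is \<open>1\<close>.\<close>

lemma emb_inj: "inj_on emb (carrier G)"
  unfolding emb.inj_on_one_iff
proof (intro allI impI)
  fix g assume g: "g \<in> carrier G" "emb g = \<one>\<^bsub>M\<^esub>"
  obtain x where x: "reduced (fst x)" "g = P.val True x" using path_surj[OF g(1)] by blast
  obtain q where "emb (P.val True (fst x, snd x)) = inv\<^bsub>M\<^esub> base_change True \<otimes>\<^bsub>M\<^esub> val (fst x, snd x) \<otimes>\<^bsub>M\<^esub> base_change q"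
    using emb_path[OF x(1)] by blast
  then have "val x \<otimes>\<^bsub>M\<^esub> base_change q = \<one>\<^bsub>M\<^esub>" "val x \<in> carrier M"
    using g x val_closed[OF x(1), of "snd x"] by (auto simp: base_change_def)
  then have "val x = inv\<^bsub>M\<^esub> base_change q" using M.inv_equality by (metis M.inv_equality base_change_closed)
  then have "val x = val (if q then ([], 0) else ([(0, ((), False))], 0))"
    by (simp add: base_change_def stable_False)
  then have "x = (if q then ([], 0) else ([(0, ((), False))], 0))"
    using val_inj[OF x(1)] k by (auto simp: cancels_def split: if_splits)
  then show "g = \<one>\<^bsub>G\<^esub>" using x(2) by (auto simp: cross_def split: if_splits)
qed

lemma image_finite_index: "finite_index_subgroup (emb ` carrier G) M"
proof -
  let ?K = "emb ` carrier G"
  have K: "subgroup ?K M" by (rule emb.img_is_subgroup)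
  have T: "T \<in> carrier M" by simp
  have aK: "a \<in> ?K" and uK: "inv\<^bsub>M\<^esub> T \<otimes>\<^bsub>M\<^esub> a \<otimes>\<^bsub>M\<^esub> T \<in> ?K" and tK: "T \<otimes>\<^bsub>M\<^esub> T \<in> ?K"
    using emb(2-4) by (metis closed imageI)+
  note K_mult = subgroup.m_closed[OF K] and K_inv = subgroup.m_inv_closed[OF K]
  have TT: "T \<otimes>\<^bsub>M\<^esub> (inv\<^bsub>M\<^esub> T \<otimes>\<^bsub>M\<^esub> x) = x" "inv\<^bsub>M\<^esub> T \<otimes>\<^bsub>M\<^esub> (T \<otimes>\<^bsub>M\<^esub> x) = x" if "x \<in> carrier M" for x
    using T that by (simp_all flip: M.m_assoc)
  \<comment> \<open>The cosets of \<open>?K\<close> represented by \<open>1\<close> and by the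
    inverse of \<open>T\<close> are permuted by right multiplication with \<open>a\<close> and
    \<open>T\<close>, because \<open>a\<close>, its conjugate by the inverse of \<open>T\<close>,
    and \<open>T T\<close> lie in \<open>?K\<close>.\<close>
  have cover: "x \<in> ?K \<or> x \<otimes>\<^bsub>M\<^esub> T \<in> ?K" if "x \<in> carrier M" for x
    using that unfolding M_def
  proof (induction rule: presented_group_right_induct)
    case one
    then show ?case using subgroup.one_closed[OF K] by (simp add: M_def)
  next
    case (gen g x)
    have x: "x \<in> carrier M" using gen(2) by (simp add: M_def)
    have "x \<otimes>\<^bsub>M\<^esub> s \<in> ?K \<or> x \<otimes>\<^bsub>M\<^esub> s \<otimes>\<^bsub>M\<^esub> T \<in> ?K" if "s = a \<or> s = T" for s
      using gen(3)
    proof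
      assume xK: "x \<in> ?K"
      show ?thesis using that K_mult[OF xK aK] K_mult[OF xK tK] x T by (auto simp: M.m_assoc)
    next
      assume xK: "x \<otimes>\<^bsub>presented_group hnn_gens (hnn_relator ` UNIV)\<^esub> T \<in> ?K"
      then have xK: "x \<otimes>\<^bsub>M\<^esub> T \<in> ?K" by (simp add: M_def)
      show ?thesis using that K_mult[OF xK uK] xK x T by (auto simp: M.m_assoc TT)
    qed
    moreover have "gen_class hnn_gens (hnn_relator ` UNIV) g = a \<or> gen_class hnn_gens (hnn_relator ` UNIV) g = T"
      by (cases g) (auto simp: base_def stable_def)
    ultimately show ?case by (simp add: M_def)
  next
    case (inv g x)
    have x: "x \<in> carrier M" using inv(2) by (simp add: M_def)
    have "x \<otimes>\<^bsub>M\<^esub> inv\<^bsub>M\<^esub> s \<in> ?K \<or> x \<otimes>\<^bsub>M\<^esub> inv\<^bsub>M\<^esub> s \<otimes>\<^bsub>M\<^esub> T \<in> ?K" if "s = a \<or> s = T" for s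
      using inv(3)
    proof
      assume xK: "x \<in> ?K"
      show ?thesis using that K_mult[OF xK K_inv[OF aK]] xK x T by (auto simp: M.m_assoc)
    next
      assume xK: "x \<otimes>\<^bsub>presented_group hnn_gens (hnn_relator ` UNIV)\<^esub> T \<in> ?K"
      then have xK: "x \<otimes>\<^bsub>M\<^esub> T \<in> ?K" by (simp add: M_def)
      show ?thesis using that K_mult[OF xK K_inv[OF uK]] K_mult[OF xK K_inv[OF tK]] x T
        by (auto simp: M.m_assoc TT M.inv_mult_group)
    qed
    moreover have "gen_class hnn_gens (hnn_relator ` UNIV) g = a \<or> gen_class hnn_gens (hnn_relator ` UNIV) g = T"
      by (cases g) (auto simp: base_def stable_def)
    ultimately show ?case by (simp add: M_def)
  qed
  have "rcosets\<^bsub>M\<^esub> ?K \<subseteq> {?K, ?K #>\<^bsub>M\<^esub> inv\<^bsub>M\<^esub> T}"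
  proof
    fix C assume "C \<in> rcosets\<^bsub>M\<^esub> ?K"
    then obtain x where x: "x \<in> carrier M" "C = ?K #>\<^bsub>M\<^esub> x" by (auto simp: RCOSETS_def)
    show "C \<in> {?K, ?K #>\<^bsub>M\<^esub> inv\<^bsub>M\<^esub> T}"
    proof (cases "x \<in> ?K")
      case True
      then show ?thesis using x M.coset_join2[OF x(1) K] by simp
    next
      case False
      then have "x \<otimes>\<^bsub>M\<^esub> T \<in> ?K" using cover[OF x(1)] by blast
      moreover have "x = x \<otimes>\<^bsub>M\<^esub> T \<otimes>\<^bsub>M\<^esub> inv\<^bsub>M\<^esub> T" using x(1) T by (simp add: M.m_assoc)
      ultimately have "x \<in> ?K #>\<^bsub>M\<^esub> inv\<^bsub>M\<^esub> T" unfolding r_coset_def by blast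
      then show ?thesis using x M.repr_independence[OF _ _ K] T by auto
    qed
  qed
  then show ?thesis using K finite_subset unfolding finite_index_subgroup_def by blast
qed

text \<open>A hyperbolic element that descends along \<open>T\<close>, turns there and comes back.\<close>

definition turn :: "unit option word set" where
  "turn = val ([(0, ((), True)), (1, ((), False))], 1)"

lemma turn_reduced: "reduced [(0, ((), True)), (1, ((), False))]"
  using k n by (simp add: cancels_def)

lemma turn_closed [simp]: "turn \<in> carrier M"
  unfolding turn_def by (rule val_closed[OF turn_reduced])

text \<open>The exponent \<open>k n z\<close> becomes \<open>k z\<close> beyond \<open>T\<close>,
  commutes there with the turning letter \<open>a\<close>, and is restored on the way back.\<close>

lemma turn_commutes:
  "a [^]\<^bsub>M\<^esub> (int k * int n * z) \<otimes>\<^bsub>M\<^esub> turn = turn \<otimes>\<^bsub>M\<^esub> a [^]\<^bsub>M\<^esub> (int k * int n * z)"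
  unfolding turn_def commutes_base_pow_iff[OF turn_reduced] using k n by simp

text \<open>Every positive power of \<open>turn\<close> has a normal form beginning with
  \<open>T\<close>, whose label \<open>k n\<close> does not divide \<open>k z\<close>. Powers are
  treated because only a power of a conjugate of \<open>turn\<close> is known to lie in the
  subgroup.\<close>

lemma turn_pow_not_commutes:
  fixes j :: nat
  assumes "\<not> int n dvd z" "j > 0"
  shows "a [^]\<^bsub>M\<^esub> (int k * z) \<otimes>\<^bsub>M\<^esub> turn [^]\<^bsub>M\<^esub> j \<noteq> turn [^]\<^bsub>M\<^esub> j \<otimes>\<^bsub>M\<^esub> a [^]\<^bsub>M\<^esub> (int k * z)"
proof -
  have "1 < int k * int n" using k n by (metis less_1_mult of_nat_1 of_nat_less_iff)
  \<comment> \<open>The trailing exponent \<open>1\<close> leaves the residue \<open>1\<close>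
    modulo \<open>k n\<close> at the seam, which keeps the inverse of \<open>T\<close> from
    cancelling against \<open>T\<close>.\<close>
  then have "cyc_reduced ([(0, ((), True)), (1, ((), False))], 1)"
    using turn_reduced by (simp add: cyc_reduced_def cancels_def)
  from nf_cyc_reduced_pow[OF this, of "j - 1"] obtain v i where
    v: "nf (turn [^]\<^bsub>M\<^esub> j) = ([(0, ((), True)), (1, ((), False))] @ v, i)"
    using assms(2) by (auto simp: turn_def)
  obtain w i' where w: "reduced w" "turn [^]\<^bsub>M\<^esub> j = val (w, i')" "nf (turn [^]\<^bsub>M\<^esub> j) = (w, i')"
    by (rule nf_cases[of "turn [^]\<^bsub>M\<^esub> j"]) simp
  have "\<not> conveys (int k * z) w (int k * z)"
    using v w(3) assms(1) k by simp
  then show ?thesis unfolding w(2) using commutes_base_pow_iff[OF w(1)] by blast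
qed

lemma T_scaling:
  fixes i :: nat
  shows "a [^]\<^bsub>M\<^esub> (int k * (z * int n ^ i)) = T [^]\<^bsub>M\<^esub> i \<otimes>\<^bsub>M\<^esub> a [^]\<^bsub>M\<^esub> (int k * z) \<otimes>\<^bsub>M\<^esub> inv\<^bsub>M\<^esub> (T [^]\<^bsub>M\<^esub> i)"
proof -
  have T: "T \<in> carrier M" by simp
  have step: "T \<otimes>\<^bsub>M\<^esub> a [^]\<^bsub>M\<^esub> (int k * q) = a [^]\<^bsub>M\<^esub> (int k * int n * q) \<otimes>\<^bsub>M\<^esub> T" for q
    using M.intertwine_int_pow[OF _ _ _ BS_relation, of q] T by (simp add: M.int_pow_pow)
  have "T [^]\<^bsub>M\<^esub> i \<otimes>\<^bsub>M\<^esub> a [^]\<^bsub>M\<^esub> (int k * z) = a [^]\<^bsub>M\<^esub> (int k * (z * int n ^ i)) \<otimes>\<^bsub>M\<^esub> T [^]\<^bsub>M\<^esub> i"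
  proof (induction i arbitrary: z)
    case (Suc i)
    have "T [^]\<^bsub>M\<^esub> Suc i \<otimes>\<^bsub>M\<^esub> a [^]\<^bsub>M\<^esub> (int k * z) = T [^]\<^bsub>M\<^esub> i \<otimes>\<^bsub>M\<^esub> (T \<otimes>\<^bsub>M\<^esub> a [^]\<^bsub>M\<^esub> (int k * z))"
      using T by (simp add: M.m_assoc)
    also have "\<dots> = T [^]\<^bsub>M\<^esub> i \<otimes>\<^bsub>M\<^esub> a [^]\<^bsub>M\<^esub> (int k * (int n * z)) \<otimes>\<^bsub>M\<^esub> T"
      unfolding step using T by (simp add: M.m_assoc mult.assoc)
    also have "\<dots> = a [^]\<^bsub>M\<^esub> (int k * (z * int n ^ Suc i)) \<otimes>\<^bsub>M\<^esub> T [^]\<^bsub>M\<^esub> Suc i"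
      unfolding Suc using T by (simp add: M.m_assoc mult_ac)
    finally show ?case .
  qed simp
  then show ?thesis using T by (simp add: M.m_assoc)
qed

lemma not_centralizer_stable:
  assumes "finite_index_subgroup A G"
  shows "\<not> centralizer_stable k n (G\<lparr>carrier := A\<rparr>)"
proof
  have A: "subgroup A G" using assms by (simp add: finite_index_subgroup_def)
  assume "centralizer_stable k n (G\<lparr>carrier := A\<rparr>)"
  then obtain c s N where cs: "c \<in> A" "s \<in> A" "(N::nat) \<ge> 2" "c \<noteq> \<one>\<^bsub>G\<^esub>"
    "s \<otimes>\<^bsub>G\<^esub> c [^]\<^bsub>G\<^esub> N = c \<otimes>\<^bsub>G\<^esub> s"
    and cen: "\<forall>g\<in>A. g \<otimes>\<^bsub>G\<^esub> c [^]\<^bsub>G\<^esub> (k * n) = c [^]\<^bsub>G\<^esub> (k * n) \<otimes>\<^bsub>G\<^esub> g \<longrightarrow>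
      g \<otimes>\<^bsub>G\<^esub> c [^]\<^bsub>G\<^esub> k = c [^]\<^bsub>G\<^esub> k \<otimes>\<^bsub>G\<^esub> g"
    unfolding G.centralizer_stable_subgroup[OF A] by blast
  have cG: "c \<in> carrier G" and sG: "s \<in> carrier G" using cs subgroup.subset[OF A] by auto
  have emb_sc: "emb s \<otimes>\<^bsub>M\<^esub> emb c [^]\<^bsub>M\<^esub> N = emb c \<otimes>\<^bsub>M\<^esub> emb s"
    using arg_cong[OF cs(5), of emb] cG sG by (simp add: emb.hom_nat_pow)
  have "\<exists>r\<in>carrier M. \<exists>j>L. emb c = r [^]\<^bsub>M\<^esub> (j :: nat)" for L
    by (rule M.ex_unbounded_roots[OF _ _ cs(3) emb_sc]) (use cG sG in simp_all)
  then obtain h z where h: "h \<in> carrier M" "emb c = h \<otimes>\<^bsub>M\<^esub> a [^]\<^bsub>M\<^esub> (z :: int) \<otimes>\<^bsub>M\<^esub> inv\<^bsub>M\<^esub> h"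
    using elliptic_if_unbounded_roots[of "emb c"] cG by (metis emb.hom_closed)
  have "z \<noteq> 0"
  proof
    assume "z = 0"
    then have "emb c = \<one>\<^bsub>M\<^esub>" using h by simp
    then show False using cG cs(4) emb_inj unfolding emb.inj_on_one_iff by blast
  qed
  then obtain i y where y: "z = y * int n ^ i" "\<not> int n dvd y" using int_power_decompose n by metis
  \<comment> \<open>The factor \<open>n ^ i\<close> of \<open>z\<close> is absorbed into the
    conjugator; \<open>T_scaling\<close> permits this for the exponents \<open>z k j\<close>, which
    are multiples of \<open>k\<close>.\<close>
  define h' where "h' = h \<otimes>\<^bsub>M\<^esub> T [^]\<^bsub>M\<^esub> i"
  have h': "h' \<in> carrier M" unfolding h'_def using h(1) by simp
  have c_pow: "emb c [^]\<^bsub>M\<^esub> (k * j) = h' \<otimes>\<^bsub>M\<^esub> a [^]\<^bsub>M\<^esub> (int k * (y * int j)) \<otimes>\<^bsub>M\<^esub> inv\<^bsub>M\<^esub> h'" for j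
  proof -
    have "emb c [^]\<^bsub>M\<^esub> (k * j) = h \<otimes>\<^bsub>M\<^esub> (a [^]\<^bsub>M\<^esub> z) [^]\<^bsub>M\<^esub> (k * j) \<otimes>\<^bsub>M\<^esub> inv\<^bsub>M\<^esub> h"
      unfolding h(2) using h(1) by (intro M.conj_nat_pow) simp_all
    also have "(a [^]\<^bsub>M\<^esub> z) [^]\<^bsub>M\<^esub> (k * j) = a [^]\<^bsub>M\<^esub> (z * int (k * j))"
      using M.int_pow_pow[of a z "int (k * j)"] int_pow_int[of M "a [^]\<^bsub>M\<^esub> z" "k * j"] by simp
    also have "z * int (k * j) = int k * (y * int j * int n ^ i)" by (simp add: y)
    finally show ?thesis
      unfolding T_scaling h'_def using h(1) by (simp add: M.m_assoc M.inv_mult_group)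
  qed
  define g where "g = h' \<otimes>\<^bsub>M\<^esub> turn \<otimes>\<^bsub>M\<^esub> inv\<^bsub>M\<^esub> h'"
  have g: "g \<in> carrier M" unfolding g_def using h' by simp
  have g_pow: "g [^]\<^bsub>M\<^esub> j = h' \<otimes>\<^bsub>M\<^esub> turn [^]\<^bsub>M\<^esub> j \<otimes>\<^bsub>M\<^esub> inv\<^bsub>M\<^esub> h'" for j :: nat
    unfolding g_def using h' by (intro M.conj_nat_pow) simp_all
  \<comment> \<open>The conjugate \<open>g\<close> of \<open>turn\<close> lives in \<open>M\<close>:
    the power \<open>D1\<close> brings it into the image of \<open>G\<close>, the power
    \<open>D2\<close> then into \<open>A\<close>.\<close>
  obtain D1 :: nat where D1: "D1 > 0" "\<forall>x\<in>carrier M. x [^]\<^bsub>M\<^esub> D1 \<in> emb ` carrier G"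
    by (rule M.pow_in_finite_index_subgroup[OF image_finite_index])
  obtain D2 :: nat where D2: "D2 > 0" "\<forall>x\<in>carrier G. x [^]\<^bsub>G\<^esub> D2 \<in> A"
    by (rule G.pow_in_finite_index_subgroup[OF assms])
  obtain f where f: "f \<in> carrier G" "g [^]\<^bsub>M\<^esub> D1 = emb f" using D1(2) g by blast
  define f' where "f' = f [^]\<^bsub>G\<^esub> D2"
  have f': "f' \<in> A" "f' \<in> carrier G" using D2(2) f(1) by (auto simp: f'_def)
  have emb_f': "emb f' = h' \<otimes>\<^bsub>M\<^esub> turn [^]\<^bsub>M\<^esub> (D1 * D2) \<otimes>\<^bsub>M\<^esub> inv\<^bsub>M\<^esub> h'"
    using f g by (simp add: f'_def emb.hom_nat_pow M.nat_pow_pow flip: g_pow f(2))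
  have comm: "f' \<otimes>\<^bsub>G\<^esub> c [^]\<^bsub>G\<^esub> (k * j) = c [^]\<^bsub>G\<^esub> (k * j) \<otimes>\<^bsub>G\<^esub> f' \<longleftrightarrow>
      turn [^]\<^bsub>M\<^esub> (D1 * D2) \<otimes>\<^bsub>M\<^esub> a [^]\<^bsub>M\<^esub> (int k * (y * int j))
        = a [^]\<^bsub>M\<^esub> (int k * (y * int j)) \<otimes>\<^bsub>M\<^esub> turn [^]\<^bsub>M\<^esub> (D1 * D2)" for j
  proof -
    have "f' \<otimes>\<^bsub>G\<^esub> c [^]\<^bsub>G\<^esub> (k * j) = c [^]\<^bsub>G\<^esub> (k * j) \<otimes>\<^bsub>G\<^esub> f' \<longleftrightarrow>
        emb f' \<otimes>\<^bsub>M\<^esub> emb c [^]\<^bsub>M\<^esub> (k * j) = emb c [^]\<^bsub>M\<^esub> (k * j) \<otimes>\<^bsub>M\<^esub> emb f'"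
      using inj_on_eq_iff[OF emb_inj, of "f' \<otimes>\<^bsub>G\<^esub> c [^]\<^bsub>G\<^esub> (k * j)" "c [^]\<^bsub>G\<^esub> (k * j) \<otimes>\<^bsub>G\<^esub> f'"] f'(2) cG
      by (simp add: emb.hom_nat_pow)
    then show ?thesis unfolding emb_f' c_pow using h' by (subst (asm) M.conj_commute_iff) simp_all
  qed
  have "a [^]\<^bsub>M\<^esub> (int k * (y * int n)) \<otimes>\<^bsub>M\<^esub> turn = turn \<otimes>\<^bsub>M\<^esub> a [^]\<^bsub>M\<^esub> (int k * (y * int n))"
    using turn_commutes[of y] by (simp add: mult_ac)
  then have "a [^]\<^bsub>M\<^esub> (int k * (y * int n)) \<otimes>\<^bsub>M\<^esub> turn [^]\<^bsub>M\<^esub> j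
      = turn [^]\<^bsub>M\<^esub> j \<otimes>\<^bsub>M\<^esub> a [^]\<^bsub>M\<^esub> (int k * (y * int n))" for j :: nat
    using M.intertwine_int_pow[of "a [^]\<^bsub>M\<^esub> (int k * (y * int n))" turn turn "int j"]
    by (simp add: int_pow_int)
  then have "f' \<otimes>\<^bsub>G\<^esub> c [^]\<^bsub>G\<^esub> (k * n) = c [^]\<^bsub>G\<^esub> (k * n) \<otimes>\<^bsub>G\<^esub> f'"
    unfolding comm by (rule HOL.sym)
  then have "f' \<otimes>\<^bsub>G\<^esub> c [^]\<^bsub>G\<^esub> (k * 1) = c [^]\<^bsub>G\<^esub> (k * 1) \<otimes>\<^bsub>G\<^esub> f'"
    using cen f'(1) by simp
  then show False
    unfolding comm using turn_pow_not_commutes[OF y(2), of "D1 * D2"] D1(1) D2(1) by simp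
qed

end

theorem theorem7p2:
  fixes k n :: nat
  assumes "k > 1" and "n > 1" and "n < k" and "[k = 1] (mod n)"
  shows "\<not> abstractly_commensurable (G1 k n) (G4 k n)"
proof
  interpret G1: graph1_group k n by unfold_locales (use assms in auto)
  interpret G4: graph4_group k n by unfold_locales (use assms in auto)
  assume "abstractly_commensurable (G1 k n) (G4 k n)"
  then obtain A B where A: "finite_index_subgroup A G1.G" and B: "finite_index_subgroup B G4.G"
    and iso: "G1.G\<lparr>carrier := A\<rparr> \<cong> G4.G\<lparr>carrier := B\<rparr>"
    unfolding abstractly_commensurable_def G1_eq G4_eq by blast
  have groups: "group (G1.G\<lparr>carrier := A\<rparr>)" "group (G4.G\<lparr>carrier := B\<rparr>)"
    using A B subgroup.subgroup_is_group[OF _ G1.G.is_group] subgroup.subgroup_is_group[OF _ G4.G.is_group]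
    by (auto simp: finite_index_subgroup_def)
  then have "G4.G\<lparr>carrier := B\<rparr> \<cong> G1.G\<lparr>carrier := A\<rparr>"
    using group.iso_sym[OF _ iso] by blast
  from centralizer_stable_iso[OF this groups(2,1) G4.centralizer_stable_finite_index[OF B]]
  show False using G1.not_centralizer_stable[OF A] by blast
qed

end
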